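(* Let $n\geq 2$ and let $\theta$ be a domestic duality of a large building $\Delta$ of type $\mathsf{A}_n$. Then $n$ is odd and $\theta$ is a symplectic polarity.
   Context: A thick building of type $\mathsf{A}_2$ is a projective plane, and a thick building of type $\mathsf{A}_n$, $n\geq3$, is a projective space $\mathsf{PG}(n,\mathbb{K})$ over a division ring $\mathbb{K}$, with type $i$ vertices the $(i-1)$-dimensional projective subspaces. Such a building is called large if it has no residue isomorphic to the Fano plane (projective plane of order $2$); for $\mathsf{A}_2$ this means it is not the Fano plane, and for $n\geq 3$ it means $\mathbb{K}$ is not the field of order $2$. A duality is an incidence-preserving bijection reversing the type order (type $i\mapsto n+1-i$). Simplices (flags) are opposite if every chamber containing either is opposite (at maximal gallery distance from) some chamber containing the other. $\theta$ is domestic if no chamber is mapped to an opposite chamber. A symplectic polarity of $\mathsf{PG}(2m-1,\mathbb{F})$, $\mathbb{F}$ a field, is a duality $U\mapsto U^{\perp}$ for a nondegenerate alternating form on $\mathbb{F}^{2m}$. *)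

theory Defs
  imports Main "HOL-Library.Cardinality"
begin

text \<open>A building of rank n is given by a vertex set V, a type function typ
(types 1..n) and a (reflexive, symmetric) incidence relation inc.
Chambers are sets of pairwise incident vertices, exactly one of each type.\<close>

definition chamber :: "nat \<Rightarrow> 'v set \<Rightarrow> ('v \<Rightarrow> nat) \<Rightarrow> ('v \<Rightarrow> 'v \<Rightarrow> bool) \<Rightarrow> 'v set \<Rightarrow> bool" where
  "chamber n V typ inc C \<longleftrightarrow>
     C \<subseteq> V \<and> bij_betw typ C {1..n} \<and> (\<forall>x\<in>C. \<forall>y\<in>C. inc x y)"

definition adjacent :: "nat \<Rightarrow> 'v set \<Rightarrow> ('v \<Rightarrow> nat) \<Rightarrow> ('v \<Rightarrow> 'v \<Rightarrow> bool) \<Rightarrow> 'v set \<Rightarrow> 'v set \<Rightarrow> bool" where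
  "adjacent n V typ inc C D \<longleftrightarrow>
     chamber n V typ inc C \<and> chamber n V typ inc D \<and> C \<noteq> D \<and> card (C \<inter> D) + 1 = n"

definition gallery :: "nat \<Rightarrow> 'v set \<Rightarrow> ('v \<Rightarrow> nat) \<Rightarrow> ('v \<Rightarrow> 'v \<Rightarrow> bool) \<Rightarrow> (nat \<Rightarrow> 'v set) \<Rightarrow> nat \<Rightarrow> bool" where
  "gallery n V typ inc g k \<longleftrightarrow>
     (\<forall>i\<le>k. chamber n V typ inc (g i)) \<and> (\<forall>i<k. adjacent n V typ inc (g i) (g (Suc i)))"

text \<open>Gallery distance (buildings are connected chamber systems).\<close>
definition gdist :: "nat \<Rightarrow> 'v set \<Rightarrow> ('v \<Rightarrow> nat) \<Rightarrow> ('v \<Rightarrow> 'v \<Rightarrow> bool) \<Rightarrow> 'v set \<Rightarrow> 'v set \<Rightarrow> nat" where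
  "gdist n V typ inc C D =
     (LEAST k. \<exists>g. gallery n V typ inc g k \<and> g 0 = C \<and> g k = D)"

definition opposite :: "nat \<Rightarrow> 'v set \<Rightarrow> ('v \<Rightarrow> nat) \<Rightarrow> ('v \<Rightarrow> 'v \<Rightarrow> bool) \<Rightarrow> 'v set \<Rightarrow> 'v set \<Rightarrow> bool" where
  "opposite n V typ inc C D \<longleftrightarrow>
     chamber n V typ inc C \<and> chamber n V typ inc D \<and>
     (\<forall>C' D'. chamber n V typ inc C' \<and> chamber n V typ inc D' \<longrightarrow>
        gdist n V typ inc C' D' \<le> gdist n V typ inc C D)"

definition duality :: "nat \<Rightarrow> 'v set \<Rightarrow> ('v \<Rightarrow> nat) \<Rightarrow> ('v \<Rightarrow> 'v \<Rightarrow> bool) \<Rightarrow> ('v \<Rightarrow> 'v) \<Rightarrow> bool" where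
  "duality n V typ inc \<theta> \<longleftrightarrow>
     bij_betw \<theta> V V \<and> (\<forall>v\<in>V. typ (\<theta> v) = n + 1 - typ v) \<and>
     (\<forall>u\<in>V. \<forall>v\<in>V. inc u v \<longleftrightarrow> inc (\<theta> u) (\<theta> v))"

definition domestic :: "nat \<Rightarrow> 'v set \<Rightarrow> ('v \<Rightarrow> nat) \<Rightarrow> ('v \<Rightarrow> 'v \<Rightarrow> bool) \<Rightarrow> ('v \<Rightarrow> 'v) \<Rightarrow> bool" where
  "domestic n V typ inc \<theta> \<longleftrightarrow>
     (\<forall>C. chamber n V typ inc C \<longrightarrow> \<not> opposite n V typ inc C (\<theta> ` C))"

section \<open>Type A_2: projective planes\<close>

definition proj_plane :: "'p set \<Rightarrow> 'l set \<Rightarrow> ('p \<Rightarrow> 'l \<Rightarrow> bool) \<Rightarrow> bool" where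
  "proj_plane P L I \<longleftrightarrow>
     (\<forall>p\<in>P. \<forall>q\<in>P. p \<noteq> q \<longrightarrow> (\<exists>!l. l \<in> L \<and> I p l \<and> I q l)) \<and>
     (\<forall>l\<in>L. \<forall>m\<in>L. l \<noteq> m \<longrightarrow> (\<exists>!p. p \<in> P \<and> I p l \<and> I p m)) \<and>
     (\<exists>a\<in>P. \<exists>b\<in>P. \<exists>c\<in>P. \<exists>d\<in>P. distinct [a,b,c,d] \<and>
        (\<forall>x\<in>{a,b,c,d}. \<forall>y\<in>{a,b,c,d}. \<forall>z\<in>{a,b,c,d}. distinct [x,y,z] \<longrightarrow>
           \<not> (\<exists>l\<in>L. I x l \<and> I y l \<and> I z l)))"

text \<open>Large: not the Fano plane, i.e. not of order 2 (the projective plane of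
order 2 is unique up to isomorphism).\<close>
definition large_plane :: "'p set \<Rightarrow> 'l set \<Rightarrow> ('p \<Rightarrow> 'l \<Rightarrow> bool) \<Rightarrow> bool" where
  "large_plane P L I \<longleftrightarrow> \<not> (\<forall>l\<in>L. card {p\<in>P. I p l} = 3)"

definition plane_vertices :: "'p set \<Rightarrow> 'l set \<Rightarrow> ('p + 'l) set" where
  "plane_vertices P L = Inl ` P \<union> Inr ` L"

fun plane_typ :: "('p + 'l) \<Rightarrow> nat" where
  "plane_typ (Inl p) = 1"
| "plane_typ (Inr l) = 2"

definition plane_inc :: "('p \<Rightarrow> 'l \<Rightarrow> bool) \<Rightarrow> ('p + 'l) \<Rightarrow> ('p + 'l) \<Rightarrow> bool" where
  "plane_inc I x y \<longleftrightarrow> x = y \<or>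
     (case (x, y) of (Inl p, Inr l) \<Rightarrow> I p l | (Inr l, Inl p) \<Rightarrow> I p l | _ \<Rightarrow> False)"

section \<open>Type A_n, n >= 3: PG(n,K), K a division ring, via left subspaces of K^(n+1)\<close>

text \<open>K^(n+1) is modelled as 'n \<Rightarrow> 'k with CARD('n) = n+1; scalars act on the left.\<close>

definition lsubspace :: "('n \<Rightarrow> 'k::division_ring) set \<Rightarrow> bool" where
  "lsubspace S \<longleftrightarrow> (\<lambda>i. 0) \<in> S \<and>
     (\<forall>x\<in>S. \<forall>y\<in>S. (\<lambda>i. x i + y i) \<in> S) \<and>
     (\<forall>c x. x \<in> S \<longrightarrow> (\<lambda>i. c * x i) \<in> S)"

definition lspan :: "('n \<Rightarrow> 'k::division_ring) set \<Rightarrow> ('n \<Rightarrow> 'k) set" where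
  "lspan B = {x. \<exists>c. x = (\<lambda>i. \<Sum>b\<in>B. c b * b i)}"

definition ldim :: "('n \<Rightarrow> 'k::division_ring) set \<Rightarrow> nat" where
  "ldim S = (LEAST d. \<exists>B. finite B \<and> card B = d \<and> B \<subseteq> S \<and> lspan B = S)"

text \<open>Vertices of PG(n,K): subspaces of vector dimension 1..n (projective
dimension 0..n-1); type = vector dimension; incidence = containment.\<close>
definition pg_vertices :: "nat \<Rightarrow> ('n \<Rightarrow> 'k::division_ring) set set" where
  "pg_vertices n = {S. lsubspace S \<and> 1 \<le> ldim S \<and> ldim S \<le> n}"

definition pg_inc :: "('n \<Rightarrow> 'k::division_ring) set \<Rightarrow> ('n \<Rightarrow> 'k) set \<Rightarrow> bool" where
  "pg_inc S T \<longleftrightarrow> S \<subseteq> T \<or> T \<subseteq> S"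

definition symplectic_polarity :: "nat \<Rightarrow> (('n \<Rightarrow> 'k::division_ring) set \<Rightarrow> ('n \<Rightarrow> 'k) set) \<Rightarrow> bool" where
  "symplectic_polarity n \<theta> \<longleftrightarrow>
     (\<forall>a b :: 'k. a * b = b * a) \<and>
     (\<exists>f :: ('n \<Rightarrow> 'k) \<Rightarrow> ('n \<Rightarrow> 'k) \<Rightarrow> 'k.
        (\<forall>a b x y z. f (\<lambda>i. a * x i + b * y i) z = a * f x z + b * f y z) \<and>
        (\<forall>a b x y z. f z (\<lambda>i. a * x i + b * y i) = a * f z x + b * f z y) \<and>
        (\<forall>x. f x x = 0) \<and>
        (\<forall>x. (\<forall>y. f x y = 0) \<longrightarrow> x = (\<lambda>i. 0)) \<and>
        (\<forall>U\<in>pg_vertices n. \<theta> U = {y. \<forall>x\<in>U. f x y = 0}))"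

end

theory Submission
  imports Defs "HOL-Library.Function_Algebras"
begin

text \<open>
  In both cases opposition of chambers is transversality of flags. For a plane, a domestic duality
  would produce a line with three absolute points through a non-absolute point, while a
  non-absolute point always exists. For \<open>PG(n,K)\<close> write \<open>R x y\<close> for \<open>y \<in> \<theta>\<langle>x\<rangle>\<close>. Starting from a
  non-absolute point one extends a flag transversal to its image as long as possible; if it never
  reaches the whole space, then a scalar other than 0 and 1 leads to a contradiction, so every
  point is absolute. Then \<open>R\<close> is symmetric, a maximal totally isotropic subspace is self-polar, so
  \<open>n + 1\<close> is even, and suitably normalised functionals with kernels \<open>\<theta>\<langle>x\<rangle>\<close> form an
  alternating form. Alternation forces linearity in the first argument and commutativity of \<open>K\<close>.
\<close>

subsection \<open>Galleries\<close>

text \<open>A duality supplies only the relation \<open>R\<close>, with no form behind it and no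
  symmetry, so left and right orthogonality must be kept apart until all points are known to be
  absolute. A third scalar enters there because conditions on \<open>p + h\<close> and
  \<open>p + a \<cdot> h\<close> can be subtracted to give one on \<open>(a - 1) \<cdot> h\<close>.
  The form is then built in the manner of the fundamental theorem of projective geometry: the polar
  of \<open>y\<close> fixes a functional up to a scalar depending on \<open>y\<close>, and a
  functional chosen for one vector \<open>e\<close> ties that scalar down through the polar of
  \<open>e + y\<close>. On the ray of \<open>e\<close> this says nothing, and values there are
  recovered as differences; this takes vectors outside the span of three others, hence dimension at
  least 4. A plane need not have coordinates, so its case is synthetic, and as 2 is even it must end
  in a contradiction. Transversal flags are opposite because the gallery distance of two complete
  flags is the number of inversions of their relative position, which is largest for the
  order-reversing permutation.\<close>

definition within ::
  "nat \<Rightarrow> 'v set \<Rightarrow> ('v \<Rightarrow> nat) \<Rightarrow> ('v \<Rightarrow> 'v \<Rightarrow> bool) \<Rightarrow> nat \<Rightarrow> 'v set \<Rightarrow> 'v set \<Rightarrow> bool"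
  where "within n V typ inc k C D \<longleftrightarrow> (\<exists>g k'. k' \<le> k \<and> gallery n V typ inc g k' \<and> g 0 = C \<and> g k' = D)"

lemma within_refl: "chamber n V typ inc C \<Longrightarrow> within n V typ inc k C C"
  unfolding within_def gallery_def by (rule exI[of _ "\<lambda>_. C"], rule exI[of _ 0]) auto

lemma within_step:
  assumes "within n V typ inc k C D" "adjacent n V typ inc D E \<or> D = E"
  shows "within n V typ inc (Suc k) C E"
proof (cases "D = E")
  case True
  obtain g k' where "k' \<le> k" "gallery n V typ inc g k'" "g 0 = C" "g k' = D"
    using assms(1) unfolding within_def by blast
  then show ?thesis using True unfolding within_def
    by (intro exI[of _ g] exI[of _ k']) auto
next
  case False
  then have adj: "adjacent n V typ inc D E" using assms(2) by blast
  obtain g k' where g: "k' \<le> k" "gallery n V typ inc g k'" "g 0 = C" "g k' = D"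
    using assms(1) unfolding within_def by blast
  have "gallery n V typ inc (g(Suc k' := E)) (Suc k')"
    using g adj unfolding gallery_def adjacent_def by (auto simp: less_Suc_eq le_Suc_eq)
  then show ?thesis using g(1,3)
    unfolding within_def by (intro exI[of _ "g(Suc k' := E)"] exI[of _ "Suc k'"]) auto
qed

lemma gdist_le:
  assumes "within n V typ inc k C D"
  shows "gdist n V typ inc C D \<le> k"
proof -
  obtain k' where k': "k' \<le> k" "\<exists>g. gallery n V typ inc g k' \<and> g 0 = C \<and> g k' = D"
    using assms unfolding within_def by blast
  have "gdist n V typ inc C D \<le> k'" unfolding gdist_def by (rule Least_le) (fact k'(2))
  then show ?thesis using k'(1) by simp
qed

text \<open>The first hypothesis guarantees that some gallery exists; otherwise the
  \<open>LEAST\<close> in \<open>gdist\<close> would be unspecified and no lower bound could be read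
  off.\<close>

lemma gdist_ge:
  assumes "within n V typ inc k C D"
    and "\<And>g j. gallery n V typ inc g j \<Longrightarrow> g 0 = C \<Longrightarrow> g j = D \<Longrightarrow> m \<le> j"
  shows "m \<le> gdist n V typ inc C D"
proof -
  have "\<exists>k g. gallery n V typ inc g k \<and> g 0 = C \<and> g k = D"
    using assms(1) unfolding within_def by blast
  from LeastI_ex[OF this] show ?thesis using assms(2) unfolding gdist_def by blast
qed

subsection \<open>Dualities of projective planes\<close>

text \<open>Not phrased with \<^const>\<open>card\<close>, which is \<open>0\<close> on the lines of an infinite plane.\<close>
definition has_four :: "'a set \<Rightarrow> bool"
  where "has_four S \<longleftrightarrow> (\<exists>A\<subseteq>S. finite A \<and> card A = 4)"

lemma has_four_avoid:
  assumes "has_four S" "finite B" "card B \<le> 3"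
  shows "\<exists>x\<in>S. x \<notin> B"
proof (rule ccontr)
  assume "\<not> ?thesis"
  then obtain A where "A \<subseteq> B" "card A = 4" using assms(1) unfolding has_four_def by blast
  then show False using card_mono[OF assms(2), of A] assms(3) by simp
qed

lemma has_four_image:
  assumes "has_four S" "inj_on f S" "f ` S \<subseteq> T"
  shows "has_four T"
proof -
  obtain A where A: "A \<subseteq> S" "finite A" "card A = 4" using assms(1) unfolding has_four_def by blast
  then have "card (f ` A) = 4" using card_image assms(2) inj_on_subset by metis
  then show ?thesis using A assms(3) unfolding has_four_def by (intro exI[of _ "f ` A"]) auto
qed

text \<open>The test \<open>card S \<noteq> 3\<close> is passed by larger finite sets and by
  infinite ones, whose \<open>card\<close> is 0; either way \<open>S\<close> has a point besides
  \<open>a\<close>, \<open>b\<close>, \<open>c\<close>.\<close>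

lemma has_fourI:
  assumes "distinct [a, b, c]" "{a, b, c} \<subseteq> S" "card S \<noteq> 3"
  shows "has_four S"
proof -
  have 3: "card {a, b, c} = 3" using assms(1) by simp
  then have "S \<noteq> {a, b, c}" using assms(3) by metis
  then obtain d where "d \<in> S" "d \<notin> {a, b, c}" using assms(2) by blast
  then show ?thesis using 3 assms(2) unfolding has_four_def
    by (intro exI[of _ "insert d {a, b, c}"]) auto
qed

lemma card_three: "card {a, b, c} \<le> 3"
  by (simp add: card_insert_if)

locale projective_plane =
  fixes P :: "'p set" and L :: "'l set" and I :: "'p \<Rightarrow> 'l \<Rightarrow> bool"
  assumes plane: "proj_plane P L I"
begin

lemma line_ex: "p \<in> P \<Longrightarrow> q \<in> P \<Longrightarrow> p \<noteq> q \<Longrightarrow> \<exists>l\<in>L. I p l \<and> I q l"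
  using plane unfolding proj_plane_def by (elim conjE) blast

lemma line_unique:
  "p \<in> P \<Longrightarrow> q \<in> P \<Longrightarrow> p \<noteq> q \<Longrightarrow> l \<in> L \<Longrightarrow> m \<in> L \<Longrightarrow> I p l \<Longrightarrow> I q l \<Longrightarrow> I p m \<Longrightarrow> I q m \<Longrightarrow> l = m"
  using plane unfolding proj_plane_def by (elim conjE) blast

lemma point_ex: "l \<in> L \<Longrightarrow> m \<in> L \<Longrightarrow> l \<noteq> m \<Longrightarrow> \<exists>p\<in>P. I p l \<and> I p m"
  using plane unfolding proj_plane_def by (elim conjE) blast

definition noncollinear :: "'p \<Rightarrow> 'p \<Rightarrow> 'p \<Rightarrow> bool"
  where "noncollinear x y z \<longleftrightarrow> \<not> (\<exists>l\<in>L. I x l \<and> I y l \<and> I z l)"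

definition quadrangle :: "'p \<Rightarrow> 'p \<Rightarrow> 'p \<Rightarrow> 'p \<Rightarrow> bool"
  where "quadrangle a b c d \<longleftrightarrow> {a, b, c, d} \<subseteq> P \<and> distinct [a, b, c, d] \<and>
    noncollinear a b c \<and> noncollinear a b d \<and> noncollinear a c d \<and> noncollinear b c d"

lemma quadrangle_ex: "\<exists>a b c d. quadrangle a b c d"
proof -
  obtain a b c d where "a \<in> P" "b \<in> P" "c \<in> P" "d \<in> P" "distinct [a, b, c, d]"
    and "\<forall>x\<in>{a,b,c,d}. \<forall>y\<in>{a,b,c,d}. \<forall>z\<in>{a,b,c,d}. distinct [x,y,z] \<longrightarrow> noncollinear x y z"
    using plane unfolding proj_plane_def noncollinear_def by (elim conjE bexE)
  then have "quadrangle a b c d" unfolding quadrangle_def by simp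
  then show ?thesis by blast
qed

lemma quadrangle_rotate: "quadrangle a b c d \<Longrightarrow> quadrangle b c d a"
  unfolding quadrangle_def noncollinear_def by auto

text \<open>Projecting the other three vertices from \<open>a\<close> onto \<open>l\<close> gives
  distinct points, since the three sides through \<open>a\<close> are distinct.\<close>

lemma quadrangle_three_points:
  assumes q: "quadrangle a b c d" and l: "l \<in> L" "\<not> I a l"
  shows "\<exists>x y z. distinct [x, y, z] \<and> {x, y, z} \<subseteq> {p\<in>P. I p l}"
proof -
  have P: "a \<in> P" "b \<in> P" "c \<in> P" "d \<in> P" and dist: "a \<noteq> b" "a \<noteq> c" "a \<noteq> d"
    using q unfolding quadrangle_def by auto
  obtain b' where b': "b' \<in> L" "I a b'" "I b b'" using line_ex P dist by blast
  obtain c' where c': "c' \<in> L" "I a c'" "I c c'" using line_ex P dist by blast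
  obtain d' where d': "d' \<in> L" "I a d'" "I d d'" using line_ex P dist by blast
  have ne: "b' \<noteq> c'" "b' \<noteq> d'" "c' \<noteq> d'"
    using q b' c' d' unfolding quadrangle_def noncollinear_def by blast+
  obtain x where x: "x \<in> P" "I x b'" "I x l" using point_ex[OF b'(1) l(1)] b' l by blast
  obtain y where y: "y \<in> P" "I y c'" "I y l" using point_ex[OF c'(1) l(1)] c' l by blast
  obtain z where z: "z \<in> P" "I z d'" "I z l" using point_ex[OF d'(1) l(1)] d' l by blast
  have "x \<noteq> y" using line_unique[OF P(1) x(1) _ b'(1) c'(1)] x y b' c' ne l by blast
  moreover have "x \<noteq> z" using line_unique[OF P(1) x(1) _ b'(1) d'(1)] x z b' d' ne l by blast
  moreover have "y \<noteq> z" using line_unique[OF P(1) y(1) _ c'(1) d'(1)] y z c' d' ne l by blast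
  ultimately have "distinct [x, y, z]" "{x, y, z} \<subseteq> {p\<in>P. I p l}" using x y z by auto
  then show ?thesis by blast
qed

lemma three_points:
  assumes "l \<in> L"
  obtains x y z where "distinct [x, y, z]" "{x, y, z} \<subseteq> {p\<in>P. I p l}"
proof -
  obtain a b c d where q: "quadrangle a b c d" using quadrangle_ex by blast
  then have "\<not> I a l \<or> \<not> I b l \<or> \<not> I c l"
    using assms unfolding quadrangle_def noncollinear_def by blast
  then show thesis
    using that quadrangle_three_points[OF _ assms] q quadrangle_rotate by metis
qed

text \<open>A diagonal point does it: the intersection of the sides \<open>ac\<close> and
  \<open>bd\<close>.\<close>

lemma quadrangle_off_lines:
  assumes q: "quadrangle a b c d" and l: "l \<in> L" "I a l" "I b l" and m: "m \<in> L" "I c m" "I d m"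
  shows "\<exists>p\<in>P. \<not> I p l \<and> \<not> I p m"
proof -
  have P: "a \<in> P" "b \<in> P" "c \<in> P" "d \<in> P" and dist: "a \<noteq> c" "b \<noteq> d"
    using q unfolding quadrangle_def by auto
  obtain s where s: "s \<in> L" "I a s" "I c s" using line_ex P dist by blast
  obtain t where t: "t \<in> L" "I b t" "I d t" using line_ex P dist by blast
  have ne: "s \<noteq> t" "s \<noteq> l" "s \<noteq> m" "\<not> I b s" "\<not> I c l" "\<not> I d s" "\<not> I a t" "\<not> I c t"
    using q s t l m unfolding quadrangle_def noncollinear_def by blast+
  obtain p where p: "p \<in> P" "I p s" "I p t" using point_ex[OF s(1) t(1)] ne by blast
  have "\<not> I p l" using line_unique[OF P(1) p(1) _ s(1) l(1)] s l p ne by blast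
  moreover have "\<not> I p m" using line_unique[OF P(3) p(1) _ s(1) m(1)] s m p ne by blast
  ultimately show ?thesis using p by blast
qed

text \<open>No three vertices of a quadrangle are collinear. So if all four lie on \<open>l\<close>
  or \<open>m\<close>, they split two and two, and a diagonal point avoids both lines.\<close>

lemma off_lines:
  assumes l: "l \<in> L" and m: "m \<in> L"
  shows "\<exists>p\<in>P. \<not> I p l \<and> \<not> I p m"
proof (rule ccontr)
  assume neg: "\<not> ?thesis"
  obtain a b c d where q: "quadrangle a b c d" using quadrangle_ex by blast
  have on: "I p l \<or> I p m" if "p \<in> {a, b, c, d}" for p
    using neg that q unfolding quadrangle_def by blast
  have nc: "\<not> (I a k \<and> I b k \<and> I c k)" "\<not> (I a k \<and> I b k \<and> I d k)"
    "\<not> (I a k \<and> I c k \<and> I d k)" "\<not> (I b k \<and> I c k \<and> I d k)" if "k \<in> L" for k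
    using q that unfolding quadrangle_def noncollinear_def by blast+
  \<comment> \<open>Together with \<open>q\<close> these cover the three ways of splitting four
    vertices into two pairs.\<close>
  have q': "quadrangle a c b d" "quadrangle a d b c"
    using q unfolding quadrangle_def noncollinear_def by auto
  have pair: "\<not> (I x j \<and> I y j \<and> I z k \<and> I w k)"
    if "quadrangle x y z w" "{j, k} = {l, m}" for x y z w j k
  proof -
    have "j \<in> L" "k \<in> L" "\<not> (\<exists>p\<in>P. \<not> I p j \<and> \<not> I p k)" using that(2) l m neg by (auto simp: doubleton_eq_iff)
    then show ?thesis using quadrangle_off_lines[OF that(1)] by metis
  qed
  have on': "I a l \<or> I a m" "I b l \<or> I b m" "I c l \<or> I c m" "I d l \<or> I d m" using on by simp_all
  have eqs: "{l, m} = {l, m}" "{m, l} = {l, m}" by auto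
  show False
    using on' nc[OF l] nc[OF m] pair[OF q eqs(1)] pair[OF q eqs(2)] pair[OF q'(1) eqs(1)]
      pair[OF q'(1) eqs(2)] pair[OF q'(2) eqs(1)] pair[OF q'(2) eqs(2)] by argo
qed

text \<open>Half of a perspectivity: points of \<open>l\<close> are joined to \<open>v\<close>. With
  \<open>has_four_range\<close> it carries the four points of one line to any other, through a
  centre off both.\<close>

lemma has_four_pencil:
  assumes "l \<in> L" "v \<in> P" "\<not> I v l" "has_four {p\<in>P. I p l}"
  shows "has_four {m\<in>L. I v m}"
proof -
  have "\<forall>p\<in>{p\<in>P. I p l}. \<exists>m. m \<in> L \<and> I v m \<and> I p m" using line_ex assms by blast
  from bchoice[OF this] obtain f where f: "\<forall>p\<in>{p\<in>P. I p l}. f p \<in> L \<and> I v (f p) \<and> I p (f p)" ..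
  have "inj_on f {p\<in>P. I p l}"
  proof (rule inj_onI, rule ccontr)
    fix p q assume *: "p \<in> {p \<in> P. I p l}" "q \<in> {p \<in> P. I p l}" "f p = f q" "p \<noteq> q"
    then have "f p \<in> L" "I v (f p)" "I p (f p)" "I q (f p)" using f by fastforce+
    moreover from this have "f p = l" using line_unique[of p q "f p" l] * assms(1) by simp
    ultimately show False using assms(3) by simp
  qed
  moreover have "f ` {p\<in>P. I p l} \<subseteq> {m\<in>L. I v m}" using f by blast
  ultimately show ?thesis using has_four_image[OF assms(4)] by blast
qed

lemma has_four_range:
  assumes "m \<in> L" "v \<in> P" "\<not> I v m" "has_four {l\<in>L. I v l}"
  shows "has_four {p\<in>P. I p m}"
proof -
  have "\<forall>l\<in>{l\<in>L. I v l}. \<exists>p. p \<in> P \<and> I p l \<and> I p m" using point_ex[of _ m] assms by blast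
  from bchoice[OF this] obtain f where f: "\<forall>l\<in>{l\<in>L. I v l}. f l \<in> P \<and> I (f l) l \<and> I (f l) m" ..
  have "inj_on f {l\<in>L. I v l}"
  proof (rule inj_onI)
    fix k l assume *: "k \<in> {l\<in>L. I v l}" "l \<in> {l\<in>L. I v l}" "f k = f l"
    then have "f k \<in> P" "I (f k) k" "I (f k) l" "I (f k) m" using f by fastforce+
    moreover from this have "f k \<noteq> v" using assms(3) by blast
    ultimately show "k = l" using line_unique[of v "f k" k l] * assms(2) by simp
  qed
  moreover have "f ` {l\<in>L. I v l} \<subseteq> {p\<in>P. I p m}" using f by blast
  ultimately show ?thesis using has_four_image[OF assms(4)] by blast
qed

context
  assumes large: "large_plane P L I"
begin

lemma has_four_points:
  assumes "m \<in> L"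
  shows "has_four {p\<in>P. I p m}"
proof -
  obtain l where l: "l \<in> L" "card {p\<in>P. I p l} \<noteq> 3" using large unfolding large_plane_def by blast
  then have 4: "has_four {p\<in>P. I p l}" using three_points[OF l(1)] has_fourI by metis
  obtain v where "v \<in> P" "\<not> I v l" "\<not> I v m" using off_lines l(1) assms by blast
  then show ?thesis using has_four_range[OF assms] has_four_pencil[OF l(1)] 4 by blast
qed

lemma has_four_lines:
  assumes "p \<in> P"
  shows "has_four {l\<in>L. I p l}"
proof -
  obtain l where "l \<in> L" "\<not> I p l"
    using quadrangle_ex line_ex line_unique assms unfolding quadrangle_def noncollinear_def
    by (metis distinct_length_2_or_more insert_subset)
  then show ?thesis using has_four_pencil assms has_four_points by blast
qed

text \<open>If \<open>x\<close> is not absolute, every line through \<open>x\<close> contains at most two absolute points, while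
  the line \<open>\<pi> x\<close> consists of absolute points. Three non-absolute points give three such
  lines, and a line through \<open>x\<close> avoiding their intersections meets them in three absolute points.\<close>
lemma not_domestic:
  assumes maps: "\<And>p. p \<in> P \<Longrightarrow> \<pi> p \<in> L" "\<And>l. l \<in> L \<Longrightarrow> \<rho> l \<in> P"
    and inj: "inj_on \<pi> P"
    and inc: "\<And>p l. p \<in> P \<Longrightarrow> l \<in> L \<Longrightarrow> I p l \<Longrightarrow> I (\<rho> l) (\<pi> p)"
  shows "\<exists>p\<in>P. \<exists>l\<in>L. I p l \<and> \<not> I p (\<pi> p) \<and> \<not> I (\<rho> l) l"
proof (rule ccontr)
  assume neg: "\<not> ?thesis"
  have pole: "I (\<rho> l) l" if "x \<in> P" "\<not> I x (\<pi> x)" "l \<in> L" "I x l" for x l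
    using neg that by blast
  \<comment> \<open>\<open>I q l\<close> puts \<open>\<rho> l\<close> on \<open>\<pi> q\<close>, so
    \<open>l\<close> and \<open>\<pi> q\<close> share the two points \<open>q\<close> and
    \<open>\<rho> l\<close>.\<close>
  have polar_eq: "\<pi> q = l" if "l \<in> L" "I (\<rho> l) l" "q \<in> P" "I q l" "I q (\<pi> q)" "q \<noteq> \<rho> l" for q l
    using line_unique[of q "\<rho> l" "\<pi> q" l] maps inc that by blast
  \<comment> \<open>Every absolute point of \<open>l\<close> other than the pole
    \<open>\<rho> l\<close> has polar \<open>l\<close>; as \<open>\<pi>\<close> is injective there
    is at most one such point.\<close>
  have two_absolute: "\<exists>q\<in>{q1, q2, q3}. \<not> I q (\<pi> q)"
    if "l \<in> L" "I (\<rho> l) l" "{q1, q2, q3} \<subseteq> {p\<in>P. I p l}" "distinct [q1, q2, q3]" for l q1 q2 q3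
  proof (rule ccontr)
    assume "\<not> ?thesis"
    then have *: "\<pi> q = l" if "q \<in> {q1, q2, q3}" "q \<noteq> \<rho> l" for q
      using polar_eq[of l q] that \<open>l \<in> L\<close> \<open>I (\<rho> l) l\<close> \<open>{q1, q2, q3} \<subseteq> {p\<in>P. I p l}\<close> by blast
    have **: "q = q'" if "q \<in> {q1, q2, q3}" "q' \<in> {q1, q2, q3}" "q \<noteq> \<rho> l" "q' \<noteq> \<rho> l" for q q'
      using *[of q] *[of q'] inj_onD[OF inj, of q q'] that \<open>{q1, q2, q3} \<subseteq> {p\<in>P. I p l}\<close> by auto
    have "q1 \<noteq> q2" "q1 \<noteq> q3" "q2 \<noteq> q3" using \<open>distinct [q1, q2, q3]\<close> by auto
    then show False using **[of q1 q2] **[of q1 q3] **[of q2 q3] by blast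
  qed
  \<comment> \<open>If all points were absolute, a line \<open>\<pi> p\<close> would pass through
    its own pole and carry three absolute points.\<close>
  have "\<exists>x\<in>P. \<not> I x (\<pi> x)"
  proof (rule ccontr)
    assume abs: "\<not> ?thesis"
    obtain p where p: "p \<in> P" using quadrangle_ex unfolding quadrangle_def by blast
    obtain x y z where xyz: "distinct [x, y, z]" "{x, y, z} \<subseteq> {q\<in>P. I q (\<pi> p)}"
      using three_points maps p by metis
    have "I (\<rho> (\<pi> p)) (\<pi> p)" using inc[of p "\<pi> p"] p maps abs by blast
    then show False using two_absolute[OF _ _ xyz(2,1)] abs xyz p maps by blast
  qed
  then obtain x where x: "x \<in> P" "\<not> I x (\<pi> x)" by blast
  \<comment> \<open>The line \<open>m\<close> through \<open>u\<close> and \<open>z\<close> contains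
    its pole, which also lies on \<open>\<pi> u\<close>. So the pole is \<open>z\<close>, and then
    \<open>z\<close> on \<open>m\<close> gives \<open>z\<close> on \<open>\<pi> z\<close>.\<close>
  have polar_absolute: "I z (\<pi> z)" if u: "u \<in> P" "\<not> I u (\<pi> u)" and z: "z \<in> P" "I z (\<pi> u)" for u z
  proof -
    have "u \<noteq> z" using u z by blast
    then obtain m where m: "m \<in> L" "I u m" "I z m" using line_ex[of u z] u z by metis
    then have "m \<noteq> \<pi> u" using u z by blast
    moreover have "I (\<rho> m) m" "I (\<rho> m) (\<pi> u)" using pole[of u m] inc[of u m] u z m by blast+
    ultimately have "z = \<rho> m" using line_unique[of z "\<rho> m" m "\<pi> u"] m u z maps by blast
    then show ?thesis using inc[of z m] u z m by blast
  qed
  \<comment> \<open>Besides \<open>x\<close> there are three more points on \<open>l\<close>, at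
    most two of them absolute.\<close>
  have nonabs: "\<exists>y\<in>P. I y l \<and> \<not> I y (\<pi> y) \<and> y \<noteq> x" if l: "l \<in> L" "I x l" for l
  proof -
    have 4: "has_four {p\<in>P. I p l}" using has_four_points l by blast
    obtain q1 where q1: "q1 \<in> P" "I q1 l" "q1 \<notin> {x}"
      using has_four_avoid[OF 4, of "{x}"] by auto
    obtain q2 where q2: "q2 \<in> P" "I q2 l" "q2 \<notin> {x, q1}"
      using has_four_avoid[OF 4, of "{x, q1}"] card_three[of x q1 q1] by auto
    obtain q3 where q3: "q3 \<in> P" "I q3 l" "q3 \<notin> {x, q1, q2}"
      using has_four_avoid[OF 4, of "{x, q1, q2}"] card_three[of x q1 q2] by blast
    show ?thesis using two_absolute[OF l(1) pole[OF x l], of q1 q2 q3] q1 q2 q3 by auto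
  qed
  obtain l where l: "l \<in> L" "I x l" using has_four_avoid[OF has_four_lines[OF x(1)], of "{}"] by auto
  obtain m where m: "m \<in> L" "I x m" "m \<noteq> l"
    using has_four_avoid[OF has_four_lines[OF x(1)], of "{l}"] by auto
  obtain y where y: "y \<in> P" "I y l" "\<not> I y (\<pi> y)" "y \<noteq> x" using nonabs l by blast
  obtain y' where y': "y' \<in> P" "I y' m" "\<not> I y' (\<pi> y')" "y' \<noteq> x" using nonabs m by blast
  have "y \<noteq> y'" using line_unique[of x y l m] x y y' l m by blast
  have inj': "\<pi> u \<noteq> \<pi> v" if "u \<noteq> v" "u \<in> P" "v \<in> P" for u v using inj that by (auto dest: inj_onD)
  \<comment> \<open>\<open>k\<close> joins \<open>x\<close> to the common point of
    \<open>\<pi> u\<close> and \<open>\<pi> v\<close>, which is absolute and hence not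
    \<open>x\<close>. Such lines are the ones to avoid later.\<close>
  have meet: "\<exists>k. k \<in> L \<and> I x k \<and> (\<forall>z\<in>P. I z (\<pi> u) \<longrightarrow> I z (\<pi> v) \<longrightarrow> I z k)"
    if u: "u \<in> P" "\<not> I u (\<pi> u)" and v: "v \<in> P" "u \<noteq> v" for u v
  proof -
    obtain z where z: "z \<in> P" "I z (\<pi> u)" "I z (\<pi> v)" using point_ex inj' maps u v by metis
    then have "z \<noteq> x" using polar_absolute[OF u] x by blast
    then obtain k where k: "k \<in> L" "I x k" "I z k" using line_ex z x by metis
    have "w = z" if "w \<in> P" "I w (\<pi> u)" "I w (\<pi> v)" for w
      using line_unique[of w z "\<pi> u" "\<pi> v"] that z maps u v inj'[OF v(2)] by blast
    then show ?thesis using k by blast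
  qed
  obtain k1 where k1: "\<forall>z\<in>P. I z (\<pi> x) \<longrightarrow> I z (\<pi> y) \<longrightarrow> I z k1" "k1 \<in> L" "I x k1"
    using meet[of x y] x y by metis
  obtain k2 where k2: "\<forall>z\<in>P. I z (\<pi> x) \<longrightarrow> I z (\<pi> y') \<longrightarrow> I z k2" "k2 \<in> L" "I x k2"
    using meet[of x y'] x y' by metis
  obtain k3 where k3: "\<forall>z\<in>P. I z (\<pi> y) \<longrightarrow> I z (\<pi> y') \<longrightarrow> I z k3" "k3 \<in> L" "I x k3"
    using meet[of y y'] x y y' \<open>y \<noteq> y'\<close> by metis
  obtain k where k: "k \<in> L" "I x k" "k \<notin> {k1, k2, k3}"
    using has_four_avoid[OF has_four_lines[OF x(1)], of "{k1, k2, k3}"] card_three[of k1 k2 k3] by auto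
  have meets: "\<exists>z\<in>P. I z k \<and> I z (\<pi> u) \<and> I z (\<pi> z) \<and> z \<noteq> x" if "u \<in> P" "\<not> I u (\<pi> u)" for u
  proof -
    have "\<not> I x (\<pi> u)" using polar_absolute[OF that x(1)] x by blast
    then show ?thesis using point_ex[of k "\<pi> u"] polar_absolute[OF that] k maps that by metis
  qed
  obtain z1 where z1: "z1 \<in> P" "I z1 k" "I z1 (\<pi> x)" "I z1 (\<pi> z1)" "z1 \<noteq> x" using meets[OF x] by blast
  obtain z2 where z2: "z2 \<in> P" "I z2 k" "I z2 (\<pi> y)" "I z2 (\<pi> z2)" "z2 \<noteq> x" using meets y by blast
  obtain z3 where z3: "z3 \<in> P" "I z3 k" "I z3 (\<pi> y')" "I z3 (\<pi> z3)" "z3 \<noteq> x" using meets y' by blast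
  \<comment> \<open>A common value would lie on \<open>k1\<close>, which would then share it and
    \<open>x\<close> with \<open>k\<close>.\<close>
  have "z1 \<noteq> z2" using line_unique[of x z1 k k1] x k z1 z2 k1 by blast
  moreover have "z1 \<noteq> z3" using line_unique[of x z1 k k2] x k z1 z3 k2 by blast
  moreover have "z2 \<noteq> z3" using line_unique[of x z2 k k3] x k z2 z3 k3 by blast
  ultimately show False
    using two_absolute[OF k(1) pole[OF x k(1,2)], of z1 z2 z3] z1 z2 z3 by auto
qed

end

section \<open>Chambers and opposition in a projective plane\<close>

abbreviation "plane_chamber \<equiv> chamber 2 (plane_vertices P L) plane_typ (plane_inc I)"
abbreviation "plane_adjacent \<equiv> adjacent 2 (plane_vertices P L) plane_typ (plane_inc I)"
abbreviation "plane_within \<equiv> within 2 (plane_vertices P L) plane_typ (plane_inc I)"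

lemma plane_chamber_iff:
  "plane_chamber C \<longleftrightarrow> (\<exists>p\<in>P. \<exists>l\<in>L. I p l \<and> C = {Inl p, Inr l})"
proof
  assume C: "plane_chamber C"
  then have bij: "bij_betw plane_typ C {1..2}" and inc: "\<forall>x\<in>C. \<forall>y\<in>C. plane_inc I x y"
    and sub: "C \<subseteq> plane_vertices P L" unfolding chamber_def by auto
  have "1 \<in> plane_typ ` C" "2 \<in> plane_typ ` C" using bij_betw_imp_surj_on[OF bij] by auto
  then obtain x y where xy: "x \<in> C" "plane_typ x = 1" "y \<in> C" "plane_typ y = 2" by fastforce
  then obtain p l where pl: "x = Inl p" "y = Inr l" by (cases x; cases y) auto
  have "z = x \<or> z = y" if "z \<in> C" for z
  proof -
    have "plane_typ z = plane_typ x \<or> plane_typ z = plane_typ y"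
      using xy by (cases z) auto
    then show ?thesis using inj_onD[OF bij_betw_imp_inj_on[OF bij] _ that] xy by metis
  qed
  then have "C = {Inl p, Inr l}" using xy pl by blast
  moreover have "I p l" using inc xy pl by (force simp: plane_inc_def)
  moreover have "p \<in> P" "l \<in> L" using sub xy pl unfolding plane_vertices_def by auto
  ultimately show "\<exists>p\<in>P. \<exists>l\<in>L. I p l \<and> C = {Inl p, Inr l}" by blast
next
  assume "\<exists>p\<in>P. \<exists>l\<in>L. I p l \<and> C = {Inl p, Inr l}"
  then obtain p l where pl: "p \<in> P" "l \<in> L" "I p l" "C = {Inl p, Inr l}" by blast
  have "{1..2::nat} = {1, 2}" by auto
  then have "bij_betw plane_typ C {1..2}" using pl by (auto simp: bij_betw_def inj_on_def)
  then show "plane_chamber C" using pl by (auto simp: chamber_def plane_vertices_def plane_inc_def)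
qed

lemma plane_adjacent_iff:
  assumes "p \<in> P" "l \<in> L" "I p l" "q \<in> P" "m \<in> L" "I q m"
  shows "plane_adjacent {Inl p, Inr l} {Inl q, Inr m} \<or> {Inl p, Inr l} = {Inl q, Inr m}
    \<longleftrightarrow> p = q \<or> l = m"
proof -
  have "{Inl p, Inr l} \<inter> {Inl q, Inr m} =
      (if p = q then {Inl p} else {}) \<union> (if l = m then {Inr l} else {})"
    by auto
  then show ?thesis unfolding adjacent_def using assms plane_chamber_iff
    by (auto simp: doubleton_eq_iff)
qed

lemma plane_within:
  assumes "p \<in> P" "l \<in> L" "I p l" "q \<in> P" "m \<in> L" "I q m"
  shows "plane_within 3 {Inl p, Inr l} {Inl q, Inr m}"
proof -
  \<comment> \<open>The gallery turns the line into \<open>s\<close>, then moves the point along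
    \<open>s\<close>, then turns the line into \<open>m\<close>. For \<open>p = q\<close> any line
    through \<open>p\<close> serves as \<open>s\<close>.\<close>
  obtain s where s: "s \<in> L" "I p s" "I q s" using line_ex[of p q] assms by (cases "p = q") auto
  have "plane_within 0 {Inl p, Inr l} {Inl p, Inr l}"
    using within_refl plane_chamber_iff assms by metis
  then have "plane_within 1 {Inl p, Inr l} {Inl p, Inr s}"
    using within_step plane_adjacent_iff[of p l p s] assms s by (metis One_nat_def)
  then have "plane_within 2 {Inl p, Inr l} {Inl q, Inr s}"
    using within_step plane_adjacent_iff[of p s q s] assms s by (metis Suc_1)
  then show ?thesis
    using within_step plane_adjacent_iff[of q s q m] assms s by (metis eval_nat_numeral(3))
qed

text \<open>Each step of a gallery keeps the point or the line, so two steps could only succeed if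
  \<open>p\<close> were on \<open>m\<close> or \<open>q\<close> on \<open>l\<close>; three steps
  always suffice.\<close>

lemma plane_opposite:
  assumes p: "p \<in> P" "l \<in> L" "I p l" and q: "q \<in> P" "m \<in> L" "I q m"
    and opp: "\<not> I p m" "\<not> I q l"
  shows "opposite 2 (plane_vertices P L) plane_typ (plane_inc I) {Inl p, Inr l} {Inl q, Inr m}"
proof -
  have "3 \<le> j" if g: "gallery 2 (plane_vertices P L) plane_typ (plane_inc I) g j"
    "g 0 = {Inl p, Inr l}" "g j = {Inl q, Inr m}" for g j
  proof (rule ccontr)
    assume "\<not> 3 \<le> j"
    then consider "j = 0" | "j = 1" | "j = 2" by linarith
    then show False
    proof cases
      case 1
      then show False using g p q opp by (auto simp: doubleton_eq_iff)
    next
      case 2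
      then have "plane_adjacent {Inl p, Inr l} {Inl q, Inr m}"
        using g unfolding gallery_def by force
      then show False using plane_adjacent_iff[OF p q] p q opp by auto
    next
      case 3
      then have g1: "plane_chamber (g 1)"
        "plane_adjacent {Inl p, Inr l} (g 1)" "plane_adjacent (g 1) {Inl q, Inr m}"
        using g unfolding gallery_def
        by (simp_all add: numeral_2_eq_2)
          (metis One_nat_def lessI less_SucI)+
      then obtain r s where r: "r \<in> P" "s \<in> L" "I r s" "g 1 = {Inl r, Inr s}"
        using plane_chamber_iff by blast
      then have "p = r \<or> l = s" "r = q \<or> s = m"
        using plane_adjacent_iff[OF p r(1-3)] plane_adjacent_iff[OF r(1-3) q] g1 by auto
      then show False using r p q opp by auto
    qed
  qed
  then have "3 \<le> gdist 2 (plane_vertices P L) plane_typ (plane_inc I) {Inl p, Inr l} {Inl q, Inr m}"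
    using gdist_ge[OF plane_within[OF p q]] by blast
  moreover have "gdist 2 (plane_vertices P L) plane_typ (plane_inc I) C D \<le> 3"
    if "plane_chamber C" "plane_chamber D" for C D
    using that plane_within gdist_le unfolding plane_chamber_iff by blast
  moreover have "plane_chamber {Inl p, Inr l}" "plane_chamber {Inl q, Inr m}"
    using p q plane_chamber_iff by blast+
  ultimately show ?thesis unfolding opposite_def using order_trans by blast
qed

lemma duality_not_domestic:
  assumes large: "large_plane P L I"
    and dual: "duality 2 (plane_vertices P L) plane_typ (plane_inc I) \<theta>"
  shows "\<not> domestic 2 (plane_vertices P L) plane_typ (plane_inc I) \<theta>"
proof -
  define \<pi> where "\<pi> p = projr (\<theta> (Inl p))" for p
  define \<rho> where "\<rho> l = projl (\<theta> (Inr l))" for l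
  have V: "Inl p \<in> plane_vertices P L \<longleftrightarrow> p \<in> P" "Inr l \<in> plane_vertices P L \<longleftrightarrow> l \<in> L" for p l
    by (auto simp: plane_vertices_def)
  have bij: "bij_betw \<theta> (plane_vertices P L) (plane_vertices P L)"
    and typ_dual: "\<And>v. v \<in> plane_vertices P L \<Longrightarrow> plane_typ (\<theta> v) = 3 - plane_typ v"
    and inc: "\<And>u v. u \<in> plane_vertices P L \<Longrightarrow> v \<in> plane_vertices P L \<Longrightarrow>
      plane_inc I u v \<longleftrightarrow> plane_inc I (\<theta> u) (\<theta> v)"
    using dual unfolding duality_def by auto
  have mem: "\<theta> v \<in> plane_vertices P L" if "v \<in> plane_vertices P L" for v
    using bij that bij_betw_apply by metis
  have \<pi>: "\<theta> (Inl p) = Inr (\<pi> p)" "\<pi> p \<in> L" if "p \<in> P" for p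
  proof -
    show "\<theta> (Inl p) = Inr (\<pi> p)"
      using typ_dual[of "Inl p"] V that unfolding \<pi>_def by (cases "\<theta> (Inl p)") auto
    then show "\<pi> p \<in> L" using mem[of "Inl p"] V that by auto
  qed
  have \<rho>: "\<theta> (Inr l) = Inl (\<rho> l)" "\<rho> l \<in> P" if "l \<in> L" for l
  proof -
    show "\<theta> (Inr l) = Inl (\<rho> l)"
      using typ_dual[of "Inr l"] V that unfolding \<rho>_def by (cases "\<theta> (Inr l)") auto
    then show "\<rho> l \<in> P" using mem[of "Inr l"] V that by auto
  qed
  have inj: "inj_on \<pi> P"
  proof (rule inj_onI)
    fix p q assume "p \<in> P" "q \<in> P" "\<pi> p = \<pi> q"
    then have "\<theta> (Inl p) = \<theta> (Inl q)" using \<pi> by simp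
    then show "p = q"
      using bij_betw_imp_inj_on[OF bij] V \<open>p \<in> P\<close> \<open>q \<in> P\<close> by (auto dest: inj_onD)
  qed
  have I: "I (\<rho> l) (\<pi> p)" if "p \<in> P" "l \<in> L" "I p l" for p l
    using inc[of "Inl p" "Inr l"] that \<pi> \<rho> V by (simp add: plane_inc_def)
  obtain p l where pl: "p \<in> P" "l \<in> L" "I p l" "\<not> I p (\<pi> p)" "\<not> I (\<rho> l) l"
    using not_domestic[OF large, of \<pi> \<rho>, OF \<pi>(2) \<rho>(2) inj I] by blast
  have "\<theta> ` {Inl p, Inr l} = {Inl (\<rho> l), Inr (\<pi> p)}" using pl \<pi> \<rho> by auto
  moreover have "opposite 2 (plane_vertices P L) plane_typ (plane_inc I)
      {Inl p, Inr l} {Inl (\<rho> l), Inr (\<pi> p)}"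
    by (rule plane_opposite[OF pl(1-3) \<rho>(2)[OF pl(2)] \<pi>(2)[OF pl(1)] I[OF pl(1-3)] pl(4,5)])
  moreover have "plane_chamber {Inl p, Inr l}" using pl plane_chamber_iff by blast
  ultimately show ?thesis unfolding domestic_def by metis
qed

end

subsection \<open>Left subspaces over a division ring\<close>

definition smul :: "'k::division_ring \<Rightarrow> ('n \<Rightarrow> 'k) \<Rightarrow> 'n \<Rightarrow> 'k" (infixr "\<cdot>" 75)
  where "c \<cdot> x = (\<lambda>i. c * x i)"

lemma smul_algebra:
  "c \<cdot> (x + y) = c \<cdot> x + c \<cdot> y" "c \<cdot> (x - y) = c \<cdot> x - c \<cdot> y"
  "(a + b) \<cdot> x = a \<cdot> x + b \<cdot> x" "(a - b) \<cdot> x = a \<cdot> x - b \<cdot> x"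
  "(- a) \<cdot> x = - (a \<cdot> x)" "a \<cdot> (- x) = - (a \<cdot> x)"
  "a \<cdot> b \<cdot> x = (a * b) \<cdot> x"
  by (simp_all add: smul_def fun_eq_iff algebra_simps)

lemma smul_simps [simp]: "0 \<cdot> x = 0" "1 \<cdot> x = x" "c \<cdot> 0 = 0"
  by (simp_all add: smul_def fun_eq_iff)

lemma lsubspace_iff:
  "lsubspace S \<longleftrightarrow> 0 \<in> S \<and> (\<forall>x\<in>S. \<forall>y\<in>S. x + y \<in> S) \<and> (\<forall>c. \<forall>x\<in>S. c \<cdot> x \<in> S)"
  by (auto simp: lsubspace_def smul_def plus_fun_def zero_fun_def)

lemma lsubspaceD:
  assumes "lsubspace S"
  shows "0 \<in> S" "x \<in> S \<Longrightarrow> y \<in> S \<Longrightarrow> x + y \<in> S" "x \<in> S \<Longrightarrow> c \<cdot> x \<in> S"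
    "x \<in> S \<Longrightarrow> - x \<in> S" "x \<in> S \<Longrightarrow> y \<in> S \<Longrightarrow> x - y \<in> S"
proof -
  show *: "0 \<in> S" "x \<in> S \<Longrightarrow> y \<in> S \<Longrightarrow> x + y \<in> S" "x \<in> S \<Longrightarrow> c \<cdot> x \<in> S" for x y c
    using assms by (auto simp: lsubspace_iff)
  show neg: "x \<in> S \<Longrightarrow> - x \<in> S" for x
    using *(3)[of x "- 1"] by (simp add: smul_algebra)
  show "x \<in> S \<Longrightarrow> y \<in> S \<Longrightarrow> x - y \<in> S"
    using *(2)[of x "- y"] neg by simp
qed

lemma smul_mem_iff:
  assumes "lsubspace S" "c \<noteq> 0"
  shows "c \<cdot> x \<in> S \<longleftrightarrow> x \<in> S"
proof
  assume "c \<cdot> x \<in> S"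
  then have "inverse c \<cdot> c \<cdot> x \<in> S" using assms lsubspaceD(3) by blast
  then show "x \<in> S" using assms(2) by (simp add: smul_algebra)
qed (use assms lsubspaceD(3) in blast)

lemma add_mem_iff:
  assumes "lsubspace S" "x \<in> S"
  shows "x + y \<in> S \<longleftrightarrow> y \<in> S" "y + x \<in> S \<longleftrightarrow> y \<in> S" "y - x \<in> S \<longleftrightarrow> y \<in> S"
proof -
  show 1: "x + y \<in> S \<longleftrightarrow> y \<in> S"
    using lsubspaceD(2)[OF assms] lsubspaceD(5)[OF assms(1) _ assms(2), of "x + y"] by auto
  then show "y + x \<in> S \<longleftrightarrow> y \<in> S" by (simp add: add.commute)
  show "y - x \<in> S \<longleftrightarrow> y \<in> S"
    using lsubspaceD(2)[OF assms, of "y - x"] lsubspaceD(5)[OF assms(1) _ assms(2), of y] by auto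
qed

lemma lsubspace_zero: "lsubspace {0}" and lsubspace_UNIV: "lsubspace UNIV"
  by (auto simp: lsubspace_iff)

lemma lsubspace_Int: "lsubspace S \<Longrightarrow> lsubspace T \<Longrightarrow> lsubspace (S \<inter> T)"
  by (auto simp: lsubspace_iff)

definition adjoin :: "('n \<Rightarrow> 'k::division_ring) set \<Rightarrow> ('n \<Rightarrow> 'k) \<Rightarrow> ('n \<Rightarrow> 'k) set"
  where "adjoin S x = {y. \<exists>c. y - c \<cdot> x \<in> S}"

lemma lsubspace_adjoin:
  assumes "lsubspace S"
  shows "lsubspace (adjoin S x)"
  unfolding lsubspace_iff
proof (intro conjI ballI allI)
  show "0 \<in> adjoin S x"
    unfolding adjoin_def using lsubspaceD(1)[OF assms] by (auto intro!: exI[of _ 0])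
next
  fix y z assume "y \<in> adjoin S x" "z \<in> adjoin S x"
  then obtain c d where "y - c \<cdot> x \<in> S" "z - d \<cdot> x \<in> S" by (auto simp: adjoin_def)
  then have "(y - c \<cdot> x) + (z - d \<cdot> x) \<in> S" using lsubspaceD(2)[OF assms] by blast
  then have "y + z - (c + d) \<cdot> x \<in> S" by (simp add: smul_algebra algebra_simps)
  then show "y + z \<in> adjoin S x" by (auto simp: adjoin_def)
next
  fix a y assume "y \<in> adjoin S x"
  then obtain c where "y - c \<cdot> x \<in> S" by (auto simp: adjoin_def)
  then have "a \<cdot> (y - c \<cdot> x) \<in> S" using lsubspaceD(3)[OF assms] by blast
  then have "a \<cdot> y - (a * c) \<cdot> x \<in> S" by (simp add: smul_algebra)
  then show "a \<cdot> y \<in> adjoin S x" by (auto simp: adjoin_def)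
qed

lemma subset_adjoin: "S \<subseteq> adjoin S x"
  by (auto simp: adjoin_def intro!: exI[of _ 0])

lemma adjoin_self: "lsubspace S \<Longrightarrow> x \<in> adjoin S x"
  by (auto simp: adjoin_def lsubspaceD intro!: exI[of _ 1])

lemma adjoin_subset_iff:
  assumes "lsubspace S" "lsubspace T"
  shows "adjoin S x \<subseteq> T \<longleftrightarrow> S \<subseteq> T \<and> x \<in> T"
proof
  assume "S \<subseteq> T \<and> x \<in> T"
  then have T: "S \<subseteq> T" "x \<in> T" by auto
  show "adjoin S x \<subseteq> T"
  proof
    fix y assume "y \<in> adjoin S x"
    then obtain c where "y - c \<cdot> x \<in> T" using T by (auto simp: adjoin_def)
    then show "y \<in> T" using add_mem_iff(3)[OF assms(2)] lsubspaceD(3)[OF assms(2) T(2)] by blast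
  qed
qed (use subset_adjoin adjoin_self[OF assms(1)] in blast)

lemma adjoin_absorb: "lsubspace S \<Longrightarrow> x \<in> S \<Longrightarrow> adjoin S x = S"
  using adjoin_subset_iff[of S S x] subset_adjoin by blast

text \<open>Steinitz exchange: the coefficient of \<open>x\<close> in \<open>y\<close> is nonzero
  because \<open>y \<notin> S\<close>, so \<open>x\<close> can be solved for.\<close>

lemma adjoin_exchange:
  assumes "lsubspace S" "y \<in> adjoin S x" "y \<notin> S"
  shows "adjoin S y = adjoin S x"
proof
  show "adjoin S y \<subseteq> adjoin S x"
    using assms adjoin_subset_iff lsubspace_adjoin subset_adjoin by metis
  obtain c where c: "y - c \<cdot> x \<in> S" using assms(2) by (auto simp: adjoin_def)
  have "c \<noteq> 0" using c assms(3) by auto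
  have "- (y - c \<cdot> x) \<in> S" using lsubspaceD(4)[OF assms(1) c] .
  then have "c \<cdot> x - 1 \<cdot> y \<in> S" by simp
  then have "c \<cdot> x \<in> adjoin S y" unfolding adjoin_def by blast
  then have "x \<in> adjoin S y" using smul_mem_iff[OF lsubspace_adjoin[OF assms(1)] \<open>c \<noteq> 0\<close>] by blast
  then show "adjoin S x \<subseteq> adjoin S y"
    using adjoin_subset_iff[OF assms(1) lsubspace_adjoin[OF assms(1)]] subset_adjoin by blast
qed

lemma adjoin_commute:
  assumes S: "lsubspace S"
  shows "adjoin (adjoin S x) y = adjoin (adjoin S y) x"
proof -
  have "adjoin (adjoin S x) y \<subseteq> adjoin (adjoin S y) x" for x y
  proof -
    note Sy = lsubspace_adjoin[OF S, of y]
    note T = lsubspace_adjoin[OF Sy, of x]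
    have "S \<subseteq> adjoin (adjoin S y) x" "y \<in> adjoin (adjoin S y) x"
      using subset_adjoin[of "adjoin S y" x] subset_adjoin[of S y] adjoin_self[OF S, of y] by blast+
    then show ?thesis
      using adjoin_subset_iff[OF S T] adjoin_subset_iff[OF lsubspace_adjoin[OF S] T] adjoin_self[OF Sy]
      by blast
  qed
  then show ?thesis by blast
qed

section \<open>Dimension as the length of a chain of one-vector extensions\<close>

inductive has_dim :: "('n \<Rightarrow> 'k::division_ring) set \<Rightarrow> nat \<Rightarrow> bool" where
  zero: "has_dim {0} 0"
| adjoin: "has_dim S m \<Longrightarrow> x \<notin> S \<Longrightarrow> has_dim (adjoin S x) (Suc m)"

lemma has_dim_lsubspace: "has_dim S m \<Longrightarrow> lsubspace S"
  by (induction rule: has_dim.induct) (auto intro: lsubspace_zero lsubspace_adjoin)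

text \<open>Relative to \<open>S\<close>, the subspace \<open>T\<close> is a hyperplane, and cutting
  with it shortens any chain for \<open>S\<close> by exactly one. This is what makes
  \<open>has_dim\<close> single-valued. Either the last extension is the one that leaves
  \<open>T\<close>, or its generator can be moved into \<open>T\<close>.\<close>

lemma has_dim_hyperplane:
  assumes "has_dim S m" "lsubspace T" "s \<in> S" "s \<notin> T" "S \<subseteq> adjoin T s"
  shows "\<exists>m'. m = Suc m' \<and> has_dim (S \<inter> T) m'"
  using assms(1,3-5)
proof (induction arbitrary: s rule: has_dim.induct)
  case zero
  then show ?case using lsubspaceD(1)[OF assms(2)] by blast
next
  case (adjoin S' m' y)
  have S': "lsubspace S'" using adjoin.hyps(1) has_dim_lsubspace by blast
  let ?S = "adjoin S' y"
  have S: "lsubspace ?S" by (rule lsubspace_adjoin[OF S'])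
  show ?case
  proof (cases "S' \<subseteq> T")
    case True
    have "y \<notin> T"
      using adjoin_subset_iff[OF S' assms(2), of y] True adjoin.prems by blast
    have "v \<in> S'" if "v \<in> ?S" "v \<in> T" for v
    proof -
      obtain c where c: "v - c \<cdot> y \<in> S'" using \<open>v \<in> ?S\<close> by (auto simp: adjoin_def)
      then have "v - (v - c \<cdot> y) \<in> T" using True that lsubspaceD(5)[OF assms(2)] by blast
      then have "c = 0" using smul_mem_iff[OF assms(2), of c y] \<open>y \<notin> T\<close> by auto
      then show ?thesis using c by simp
    qed
    then have "?S \<inter> T = S'" using True subset_adjoin by blast
    then show ?thesis using adjoin.hyps(1) by auto
  next
    case False
    then obtain s' where s': "s' \<in> S'" "s' \<notin> T" by blast
    have eq: "adjoin T s' = adjoin T s"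
      by (rule adjoin_exchange[OF assms(2)]) (use s' adjoin.prems(3) subset_adjoin in blast)+
    have "S' \<subseteq> adjoin T s'" using adjoin.prems(3) subset_adjoin[of S' y] eq by blast
    then obtain k where k: "m' = Suc k" "has_dim (S' \<inter> T) k" using adjoin.IH s' by blast
    have "y \<in> adjoin T s'" using adjoin.prems(3) adjoin_self[OF S'] eq by blast
    then obtain c where c: "y - c \<cdot> s' \<in> T" by (auto simp: adjoin_def)
    \<comment> \<open>\<open>y'\<close> lies in \<open>T\<close> and agrees with \<open>y\<close>
      modulo \<open>S'\<close>, so it can replace \<open>y\<close> as last generator.\<close>
    define y' where "y' = y - c \<cdot> s'"
    have cs: "c \<cdot> s' \<in> S'" using lsubspaceD(3)[OF S' s'(1)] .
    have y'S: "y' \<notin> S'" using add_mem_iff(3)[OF S' cs] adjoin.hyps(2) by (simp add: y'_def)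
    have "adjoin (S' \<inter> T) y' = ?S \<inter> T"
    proof
      have "y' \<in> ?S" unfolding y'_def
        using lsubspaceD(5)[OF S] adjoin_self[OF S'] cs subset_adjoin by blast
      then show "adjoin (S' \<inter> T) y' \<subseteq> ?S \<inter> T"
        using adjoin_subset_iff[OF lsubspace_Int[OF S' assms(2)] lsubspace_Int[OF S assms(2)]]
          c subset_adjoin[of S' y] by (auto simp: y'_def)
      show "?S \<inter> T \<subseteq> adjoin (S' \<inter> T) y'"
      proof
        fix v assume v: "v \<in> ?S \<inter> T"
        then obtain d where d: "v - d \<cdot> y \<in> S'" by (auto simp: adjoin_def)
        have "v - d \<cdot> y' = (v - d \<cdot> y) + d \<cdot> c \<cdot> s'" by (simp add: y'_def smul_algebra)
        then have "v - d \<cdot> y' \<in> S'" using lsubspaceD(2)[OF S' d lsubspaceD(3)[OF S' cs, of d]] by (simp only:)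
        moreover have "v - d \<cdot> y' \<in> T" using v c lsubspaceD[OF assms(2)] by (auto simp: y'_def)
        ultimately show "v \<in> adjoin (S' \<inter> T) y'" by (auto simp: adjoin_def)
      qed
    qed
    then show ?thesis using has_dim.adjoin[OF k(2), of y'] y'S k(1) by auto
  qed
qed

text \<open>Cutting \<open>adjoin S x\<close> with \<open>S\<close> turns any other chain for it
  into a chain for \<open>S\<close> that is one shorter.\<close>

lemma has_dim_unique: "has_dim S m \<Longrightarrow> has_dim S m' \<Longrightarrow> m = m'"
proof (induction arbitrary: m' rule: has_dim.induct)
  case zero
  then show ?case
  proof (cases rule: has_dim.cases)
    case (adjoin S m x)
    then have "x \<in> {0}" "0 \<in> S"
      using adjoin_self[of S x] has_dim_lsubspace lsubspaceD(1) by metis+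
    then show ?thesis using adjoin(4) by blast
  qed simp
next
  case (adjoin S m x)
  have S: "lsubspace S" using adjoin.hyps(1) has_dim_lsubspace by blast
  have "adjoin S x \<inter> S = S" using subset_adjoin by blast
  then show ?case
    using has_dim_hyperplane[OF adjoin.prems S adjoin_self[OF S] adjoin.hyps(2)] adjoin.IH by auto
qed

lemma has_dim_subspace:
  "has_dim T n \<Longrightarrow> lsubspace S \<Longrightarrow> S \<subseteq> T \<Longrightarrow> \<exists>m\<le>n. has_dim S m \<and> (m = n \<longrightarrow> S = T)"
proof (induction arbitrary: S rule: has_dim.induct)
  case zero
  then have "S = {0}" using lsubspaceD(1) by blast
  then show ?case using has_dim.zero by auto
next
  case (adjoin T n x)
  have T: "lsubspace T" using adjoin.hyps(1) has_dim_lsubspace by blast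
  obtain m where m: "m \<le> n" "has_dim (S \<inter> T) m" "m = n \<longrightarrow> S \<inter> T = T"
    using adjoin.IH[OF lsubspace_Int[OF adjoin.prems(1) T]] by blast
  show ?case
  proof (cases "S \<subseteq> T")
    case True
    then have "has_dim S m" using m(2) by (simp add: Int_absorb2)
    then show ?thesis using m(1) by (intro exI[of _ m]) auto
  next
    case False
    then obtain s where s: "s \<in> S" "s \<notin> T" by blast
    have ST: "lsubspace (S \<inter> T)" using lsubspace_Int[OF adjoin.prems(1) T] .
    have ex: "adjoin T s = adjoin T x" using adjoin_exchange[OF T] s adjoin.prems(2) by blast
    have "adjoin (S \<inter> T) s = S"
    proof
      show "adjoin (S \<inter> T) s \<subseteq> S" using adjoin_subset_iff[OF ST adjoin.prems(1)] s by blast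
      show "S \<subseteq> adjoin (S \<inter> T) s"
      proof
        fix v assume v: "v \<in> S"
        then have "v \<in> adjoin T s" using ex adjoin.prems(2) by blast
        then obtain c where "v - c \<cdot> s \<in> T" by (auto simp: adjoin_def)
        moreover have "v - c \<cdot> s \<in> S" using v s lsubspaceD[OF adjoin.prems(1)] by blast
        ultimately show "v \<in> adjoin (S \<inter> T) s" by (auto simp: adjoin_def)
      qed
    qed
    then have "has_dim S (Suc m)" using has_dim.adjoin[OF m(2), of s] s by simp
    moreover have "S = adjoin T x" if "Suc m = Suc n"
      using that m(3) \<open>adjoin (S \<inter> T) s = S\<close> ex by auto
    ultimately show ?thesis using m(1) by (intro exI[of _ "Suc m"]) auto
  qed
qed

section \<open>Spanning sets and \<open>ldim\<close>\<close>

lemma lspan_empty: "lspan {} = {0}"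
  by (auto simp: lspan_def zero_fun_def)

lemma lspan_insert:
  assumes "finite B" "b \<notin> B"
  shows "lspan (insert b B) = adjoin (lspan B) b"
proof (intro set_eqI iffI)
  fix x assume "x \<in> lspan (insert b B)"
  then obtain c where "x = (\<lambda>i. \<Sum>b\<in>insert b B. c b * b i)" by (auto simp: lspan_def)
  then have "x - c b \<cdot> b = (\<lambda>i. \<Sum>b\<in>B. c b * b i)"
    using assms by (auto simp: smul_def fun_eq_iff)
  then show "x \<in> adjoin (lspan B) b" unfolding adjoin_def lspan_def by blast
next
  fix x assume "x \<in> adjoin (lspan B) b"
  then obtain d c where "x - d \<cdot> b = (\<lambda>i. \<Sum>b\<in>B. c b * b i)" by (auto simp: adjoin_def lspan_def)
  then have "x i = d * b i + (\<Sum>b\<in>B. c b * b i)" for i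
    by (auto simp: smul_def fun_eq_iff algebra_simps)
  moreover have "(\<Sum>b'\<in>insert b B. (c(b := d)) b' * b' i) = d * b i + (\<Sum>b\<in>B. c b * b i)" for i
    using assms by (auto intro!: sum.cong)
  ultimately have "x = (\<lambda>i. \<Sum>b'\<in>insert b B. (c(b := d)) b' * b' i)" by auto
  then show "x \<in> lspan (insert b B)" unfolding lspan_def by blast
qed

lemma has_dim_lspan: "finite B \<Longrightarrow> \<exists>m\<le>card B. has_dim (lspan B) m"
proof (induction rule: finite_induct)
  case empty
  then show ?case by (auto simp: lspan_empty intro: has_dim.zero)
next
  case (insert b B)
  then obtain m where m: "m \<le> card B" "has_dim (lspan B) m" by blast
  show ?case
  proof (cases "b \<in> lspan B")
    case True
    then have "lspan (insert b B) = lspan B"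
      using lspan_insert insert adjoin_absorb has_dim_lsubspace m by metis
    then show ?thesis using m insert by (intro exI[of _ m]) auto
  next
    case False
    then show ?thesis using has_dim.adjoin[OF m(2) False] m insert
      by (intro exI[of _ "Suc m"]) (auto simp: lspan_insert)
  qed
qed

lemma has_dim_basis: "has_dim S m \<Longrightarrow> \<exists>B. finite B \<and> card B = m \<and> B \<subseteq> S \<and> lspan B = S"
proof (induction rule: has_dim.induct)
  case zero
  then show ?case by (intro exI[of _ "{}"]) (auto simp: lspan_empty)
next
  case (adjoin S m x)
  then obtain B where B: "finite B" "card B = m" "B \<subseteq> S" "lspan B = S" by blast
  then have "x \<notin> B" using adjoin by blast
  moreover have "insert x B \<subseteq> adjoin S x"
    using B subset_adjoin adjoin_self adjoin.hyps(1) has_dim_lsubspace by blast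
  ultimately show ?case using B by (intro exI[of _ "insert x B"]) (auto simp: lspan_insert)
qed

text \<open>A spanning set of size \<open>d\<close> yields a chain of length at most
  \<open>d\<close>; uniqueness of the length turns this into the lower bound for the
  \<open>LEAST\<close>.\<close>

lemma ldim_eqI: "has_dim S m \<Longrightarrow> ldim S = m"
  unfolding ldim_def
proof (rule Least_equality)
  assume "has_dim S m"
  then show "\<exists>B. finite B \<and> card B = m \<and> B \<subseteq> S \<and> lspan B = S" by (rule has_dim_basis)
  fix d assume "\<exists>B. finite B \<and> card B = d \<and> B \<subseteq> S \<and> lspan B = S"
  then show "m \<le> d" using has_dim_lspan has_dim_unique \<open>has_dim S m\<close> by blast
qed

lemma has_dim_UNIV: "has_dim (UNIV :: ('n::finite \<Rightarrow> 'k::division_ring) set) CARD('n)"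
proof -
  \<comment> \<open>The generalisation to vectors supported on \<open>A\<close> allows induction on
    the set of coordinates.\<close>
  have "has_dim {x :: 'n \<Rightarrow> 'k. \<forall>i. i \<notin> A \<longrightarrow> x i = 0} (card A)" for A :: "'n set"
    using finite[of A]
  proof (induction rule: finite_induct)
    case empty
    have "{x :: 'n \<Rightarrow> 'k. \<forall>i. i \<notin> {} \<longrightarrow> x i = 0} = {0}" by (auto simp: fun_eq_iff)
    then show ?case using has_dim.zero by simp
  next
    case (insert a A)
    let ?e = "\<lambda>i. if i = a then 1 else 0 :: 'k"
    have "x - c \<cdot> ?e \<in> {x. \<forall>i. i \<notin> A \<longrightarrow> x i = 0} \<longleftrightarrow>
        (\<forall>i. i \<notin> A \<longrightarrow> x i = (if i = a then c else 0))" for x c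
      by (auto simp: smul_def)
    then have "adjoin {x. \<forall>i. i \<notin> A \<longrightarrow> x i = 0} ?e = {x. \<forall>i. i \<notin> insert a A \<longrightarrow> x i = 0}"
      using insert(2) by (auto simp: adjoin_def)
    moreover have "?e \<notin> {x. \<forall>i. i \<notin> A \<longrightarrow> x i = 0}" using insert(2) by auto
    ultimately show ?case using has_dim.adjoin[OF insert(3)] insert(1,2) by fastforce
  qed
  from this[of UNIV] show ?thesis by simp
qed

context
  fixes S :: "('n::finite \<Rightarrow> 'k::division_ring) set"
  assumes S: "lsubspace S"
begin

lemma has_dim_ldim: "has_dim S (ldim S)"
  using has_dim_subspace[OF has_dim_UNIV S] ldim_eqI by blast

lemma ldim_adjoin: "x \<notin> S \<Longrightarrow> ldim (adjoin S x) = Suc (ldim S)"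
  using has_dim.adjoin[OF has_dim_ldim] ldim_eqI by blast

end

lemma ldim_adjoin_le:
  fixes S :: "('n::finite \<Rightarrow> 'k::division_ring) set"
  assumes "lsubspace S"
  shows "ldim (adjoin S x) \<le> Suc (ldim S)"
  using ldim_adjoin[OF assms, of x] adjoin_absorb[OF assms, of x] by (cases "x \<in> S") auto

lemma ldim_zero: "ldim {0} = 0"
  using has_dim.zero ldim_eqI by blast

lemma ldim_UNIV: "ldim (UNIV :: ('n::finite \<Rightarrow> 'k::division_ring) set) = CARD('n)"
  using has_dim_UNIV ldim_eqI by blast

lemma ldim_mono:
  fixes S T :: "('n::finite \<Rightarrow> 'k::division_ring) set"
  assumes "lsubspace S" "lsubspace T" "S \<subseteq> T"
  shows "ldim S \<le> ldim T" "ldim S = ldim T \<Longrightarrow> S = T"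
  using has_dim_subspace[OF has_dim_ldim[OF assms(2)] assms(1,3)] ldim_eqI by blast+

lemma ldim_eq_0_iff:
  fixes S :: "('n::finite \<Rightarrow> 'k::division_ring) set"
  assumes "lsubspace S"
  shows "ldim S = 0 \<longleftrightarrow> S = {0}"
  using ldim_mono[OF lsubspace_zero assms] lsubspaceD(1)[OF assms] ldim_zero by auto

lemma ldim_le:
  fixes S :: "('n::finite \<Rightarrow> 'k::division_ring) set"
  assumes "lsubspace S"
  shows "ldim S \<le> CARD('n)" "ldim S = CARD('n) \<longleftrightarrow> S = UNIV"
  using ldim_mono[OF assms lsubspace_UNIV] ldim_UNIV[where 'n='n and 'k='k] by auto

lemma pg_vertices_iff:
  fixes S :: "('n::finite \<Rightarrow> 'k::division_ring) set"
  shows "S \<in> pg_vertices (CARD('n) - 1) \<longleftrightarrow> lsubspace S \<and> S \<noteq> {0} \<and> S \<noteq> UNIV"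
proof -
  have "1 \<le> ldim S \<and> ldim S \<le> CARD('n) - 1 \<longleftrightarrow> S \<noteq> {0} \<and> S \<noteq> UNIV" if "lsubspace S"
    using ldim_eq_0_iff[OF that] ldim_le[OF that] by auto
  then show ?thesis unfolding pg_vertices_def by auto
qed

subsection \<open>Relative position of complete flags\<close>

text \<open>Inversions are recorded by their values, not their positions. Exchanging the values at
  two neighbouring positions then leaves all other recorded pairs untouched.\<close>

definition inversions :: "nat \<Rightarrow> (nat \<Rightarrow> nat) \<Rightarrow> (nat \<times> nat) set" where
  "inversions N w = {(a, b). a < b \<and> (\<exists>j j'. 1 \<le> j \<and> j < j' \<and> j' \<le> N \<and> a = w j' \<and> b = w j)}"

lemma inversionsI: "w j' < w j \<Longrightarrow> 1 \<le> j \<Longrightarrow> j < j' \<Longrightarrow> j' \<le> N \<Longrightarrow> (w j', w j) \<in> inversions N w"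
  unfolding inversions_def by blast

definition all_pairs :: "nat \<Rightarrow> (nat \<times> nat) set" where
  "all_pairs N = {(a, b). 1 \<le> a \<and> a < b \<and> b \<le> N}"

lemma finite_all_pairs: "finite (all_pairs N)"
  by (rule finite_subset[of _ "{..N} \<times> {..N}"]) (auto simp: all_pairs_def)

lemma inversions_subset:
  assumes "bij_betw w {1..N} {1..N}"
  shows "inversions N w \<subseteq> all_pairs N"
proof -
  have "w j \<in> {1..N}" if "j \<in> {1..N}" for j using assms that bij_betw_apply by metis
  then show ?thesis by (fastforce simp: inversions_def all_pairs_def)
qed

lemma inversions_cong: "(\<And>j. j \<in> {1..N} \<Longrightarrow> w j = w' j) \<Longrightarrow> inversions N w = inversions N w'"
  unfolding inversions_def by (auto; metis atLeastAtMost_iff less_imp_le_nat order_trans)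

lemma inversions_swap:
  assumes k: "1 \<le> k" "k < N"
    and same: "\<And>j. j \<in> {1..N} \<Longrightarrow> j \<noteq> k \<Longrightarrow> j \<noteq> Suc k \<Longrightarrow> w' j = w j"
    and swap: "w' k = w (Suc k)" "w' (Suc k) = w k"
  shows "inversions N w' \<subseteq> insert (w k, w (Suc k)) (inversions N w)"
proof
  fix p assume "p \<in> inversions N w'"
  then obtain j j' where j: "1 \<le> j" "j < j'" "j' \<le> N" and p: "p = (w' j', w' j)" "w' j' < w' j"
    by (auto simp: inversions_def)
  \<comment> \<open>This transposition preserves the order of every pair of positions except
    \<open>(k, Suc k)\<close>.\<close>
  define \<sigma> where "\<sigma> i = (if i = k then Suc k else if i = Suc k then k else i)" for i
  have w': "w' i = w (\<sigma> i)" if "i \<in> {1..N}" for i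
    using same[OF that] swap by (auto simp: \<sigma>_def)
  show "p \<in> insert (w k, w (Suc k)) (inversions N w)"
  proof (cases "j = k \<and> j' = Suc k")
    case True
    then show ?thesis using p swap by simp
  next
    case False
    then have "1 \<le> \<sigma> j" "\<sigma> j < \<sigma> j'" "\<sigma> j' \<le> N" using j k by (auto simp: \<sigma>_def)
    then show ?thesis using p w'[of j] w'[of j'] j by (auto simp: inversions_def)
  qed
qed

text \<open>Both functions have the same sum over \<open>A\<close>, so no inequality can be
  strict.\<close>

lemma bij_betw_le_imp_eq:
  fixes u w :: "nat \<Rightarrow> nat"
  assumes "finite A" "bij_betw u A A" "bij_betw w A A" "\<And>j. j \<in> A \<Longrightarrow> u j \<le> w j" "j \<in> A"
  shows "u j = w j"
proof (rule sum_mono_inv[of u A w])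
  show "sum u A = sum w A"
    using sum.reindex_bij_betw[OF assms(2), of "\<lambda>x. x"] sum.reindex_bij_betw[OF assms(3), of "\<lambda>x. x"]
    by simp
qed (use assms in auto)

lemma ascending_bij_eq:
  fixes w :: "nat \<Rightarrow> nat"
  assumes "bij_betw w {1..N} {1..N}" "\<And>k. 1 \<le> k \<Longrightarrow> k < N \<Longrightarrow> w k \<le> w (Suc k)" "j \<in> {1..N}"
  shows "w j = j"
proof -
  have "i \<le> w i" if "i \<in> {1..N}" for i
    using that
  proof (induction i)
    case (Suc i)
    show ?case
    proof (cases "i = 0")
      case True
      have "w (Suc i) \<in> {1..N}" using bij_betw_apply[OF assms(1) Suc.prems] .
      then show ?thesis using True by simp
    next
      case False
      then have "i \<le> w i" "w i \<le> w (Suc i)" using Suc assms(2)[of i] by auto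
      moreover have "w i \<noteq> w (Suc i)"
        using inj_onD[OF bij_betw_imp_inj_on[OF assms(1)], of i "Suc i"] Suc.prems False by auto
      ultimately show ?thesis by simp
    qed
  qed simp
  then show ?thesis
    using bij_betw_le_imp_eq[of "{1..N}" "\<lambda>x. x" w j] assms(1,3) by (auto simp: bij_betw_def)
qed

text \<open>The bound forces \<open>w\<close> to be the order-reversing permutation, which inverts
  every pair.\<close>

lemma descending_bij_eq:
  assumes "bij_betw w {1..N} {1..N}" "\<And>j. j \<in> {1..N} \<Longrightarrow> N + 1 - j \<le> w j"
  shows "inversions N w = all_pairs N"
proof -
  have "bij_betw (\<lambda>j. N + 1 - j) {1..N} {1..N}"
    unfolding bij_betw_def by (intro conjI endo_inj_surj) (auto simp: inj_on_def)
  then have eq: "N + 1 - j = w j" if "j \<in> {1..N}" for j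
    using bij_betw_le_imp_eq[of "{1..N}" "\<lambda>j. N + 1 - j" w j] assms that by auto
  have "all_pairs N \<subseteq> inversions N w"
  proof
    fix p assume "p \<in> all_pairs N"
    then obtain a b where p: "p = (a, b)" "1 \<le> a" "a < b" "b \<le> N" by (auto simp: all_pairs_def)
    then have "N + 1 - a \<in> {1..N}" "N + 1 - b \<in> {1..N}" by auto
    then have "w (N + 1 - a) = a" "w (N + 1 - b) = b"
      using eq[of "N + 1 - a"] eq[of "N + 1 - b"] p by auto
    then show "p \<in> inversions N w" using p inversionsI[of w "N + 1 - a" "N + 1 - b" N] by auto
  qed
  then show ?thesis using inversions_subset[OF assms(1)] by blast
qed

text \<open>The zero space and the whole space, absent from chambers, are included as members 0 and
  \<open>CARD('n)\<close>, so that every quotient of consecutive members is one-dimensional.\<close>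

definition complete_flag :: "(nat \<Rightarrow> ('n::finite \<Rightarrow> 'k::division_ring) set) \<Rightarrow> bool" where
  "complete_flag F \<longleftrightarrow> (\<forall>i\<le>CARD('n). lsubspace (F i) \<and> ldim (F i) = i) \<and>
     (\<forall>i j. i \<le> j \<longrightarrow> j \<le> CARD('n) \<longrightarrow> F i \<subseteq> F j)"

text \<open>The relative position of two complete flags \<open>F\<close> and \<open>G\<close> as a permutation:
  \<open>position F G j\<close> is the step of the filtration \<open>F\<close> induced on \<open>G j / G (j - 1)\<close> at which
  this one-dimensional quotient appears.\<close>
definition position :: "(nat \<Rightarrow> 'a set) \<Rightarrow> (nat \<Rightarrow> 'a set) \<Rightarrow> nat \<Rightarrow> nat" where
  "position F G j = (LEAST i. \<not> F i \<inter> G j \<subseteq> G (j - 1))"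

context
  fixes F :: "nat \<Rightarrow> ('n::finite \<Rightarrow> 'k::division_ring) set"
  assumes F: "complete_flag F"
begin

lemma flag_lsubspace: "i \<le> CARD('n) \<Longrightarrow> lsubspace (F i)"
  and flag_ldim: "i \<le> CARD('n) \<Longrightarrow> ldim (F i) = i"
  and flag_mono: "i \<le> j \<Longrightarrow> j \<le> CARD('n) \<Longrightarrow> F i \<subseteq> F j"
  using F unfolding complete_flag_def by blast+

lemma flag_zero: "F 0 = {0}"
  using flag_lsubspace[of 0] flag_ldim[of 0] ldim_eq_0_iff by auto

lemma flag_top: "F CARD('n) = UNIV"
  using flag_lsubspace flag_ldim ldim_le(2) by blast

lemma flag_adjoin:
  assumes "Suc i \<le> CARD('n)" "x \<in> F (Suc i)" "x \<notin> F i"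
  shows "adjoin (F i) x = F (Suc i)"
proof (rule ldim_mono(2))
  show "lsubspace (adjoin (F i) x)" using assms(1) lsubspace_adjoin[OF flag_lsubspace[of i]] by simp
  show "lsubspace (F (Suc i))" using assms flag_lsubspace by blast
  then show "adjoin (F i) x \<subseteq> F (Suc i)"
    using assms adjoin_subset_iff[of "F i" "F (Suc i)"] flag_lsubspace[of i] flag_mono[of i "Suc i"] by auto
  show "ldim (adjoin (F i) x) = ldim (F (Suc i))"
    using assms ldim_adjoin[of "F i"] flag_lsubspace[of i] flag_ldim[of i] flag_ldim[of "Suc i"] by simp
qed

lemma flag_not_subset: "Suc i \<le> CARD('n) \<Longrightarrow> \<not> F (Suc i) \<subseteq> F i"
  using ldim_mono(1)[of "F (Suc i)" "F i"] flag_lsubspace[of i] flag_lsubspace[of "Suc i"]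
    flag_ldim[of i] flag_ldim[of "Suc i"] by auto

end

lemma position_cases:
  fixes F G :: "nat \<Rightarrow> ('n::finite \<Rightarrow> 'k::division_ring) set"
  assumes F: "complete_flag F" and G: "complete_flag G" and j: "j \<in> {1..CARD('n)}"
  obtains i x where "position F G j = Suc i" "i < CARD('n)"
    "x \<in> F (Suc i)" "x \<in> G j" "x \<notin> G (j - 1)" "F i \<inter> G j \<subseteq> G (j - 1)"
proof -
  let ?P = "\<lambda>i. \<not> F i \<inter> G j \<subseteq> G (j - 1)"
  obtain j' where j': "j = Suc j'" "Suc j' \<le> CARD('n)" using j by (cases j) auto
  have top: "?P CARD('n)" using flag_top[OF F] flag_not_subset[OF G] j' by simp
  have P: "?P (position F G j)" unfolding position_def by (rule LeastI[of ?P, OF top])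
  have le: "position F G j \<le> CARD('n)" unfolding position_def by (rule Least_le[of ?P, OF top])
  have "position F G j \<noteq> 0"
  proof
    assume "position F G j = 0"
    then have "\<not> {0} \<subseteq> G j'" using P flag_zero[OF F] j' by auto
    then show False using lsubspaceD(1)[OF flag_lsubspace[OF G]] j' by simp
  qed
  then obtain i where i: "position F G j = Suc i" by (cases "position F G j") auto
  then have "i < (LEAST i. ?P i)" by (simp add: position_def)
  from not_less_Least[OF this] have "F i \<inter> G j \<subseteq> G (j - 1)" by blast
  moreover obtain x where "x \<in> F (Suc i)" "x \<in> G j" "x \<notin> G (j - 1)" using P i by auto
  ultimately show thesis using that[of i x] i le by auto
qed

lemma position_le:
  assumes "x \<in> F i" "x \<in> G j" "x \<notin> G (j - 1)"
  shows "position F G j \<le> i"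
  unfolding position_def by (rule Least_le) (use assms in blast)

text \<open>If both quotients appeared at the same step, then, \<open>F (Suc i) / F i\<close> being
  one-dimensional, \<open>y - c \<cdot> x\<close> would lie in \<open>F i\<close> for some
  \<open>c\<close>, hence in \<open>G (j' - 1)\<close>. But \<open>x\<close> is already in
  \<open>G (j' - 1)\<close>, so \<open>y\<close> would be as well.\<close>

lemma position_neq:
  fixes F G :: "nat \<Rightarrow> ('n::finite \<Rightarrow> 'k::division_ring) set"
  assumes F: "complete_flag F" and G: "complete_flag G" and j: "1 \<le> j" "j < j'" "j' \<le> CARD('n)"
  shows "position F G j \<noteq> position F G j'"
proof
  assume eq: "position F G j = position F G j'"
  have jA: "j \<in> {1..CARD('n)}" "j' \<in> {1..CARD('n)}" using j by auto
  obtain i x where x: "position F G j = Suc i" "i < CARD('n)"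
    "x \<in> F (Suc i)" "x \<in> G j" "x \<notin> G (j - 1)" "F i \<inter> G j \<subseteq> G (j - 1)"
    using position_cases[OF F G jA(1)] by metis
  obtain i' y where y: "position F G j' = Suc i'" "y \<in> F (Suc i')" "y \<in> G j'" "y \<notin> G (j' - 1)"
    "F i' \<inter> G j' \<subseteq> G (j' - 1)"
    using position_cases[OF F G jA(2)] by metis
  have i': "i' = i" using eq x(1) y(1) by simp
  have "x \<notin> F i" using x by blast
  then have "y \<in> adjoin (F i) x" using flag_adjoin[OF F, of i x] x y i' by simp
  then obtain c where c: "y - c \<cdot> x \<in> F i" by (auto simp: adjoin_def)
  have "G j \<subseteq> G (j' - 1)" "G (j' - 1) \<subseteq> G j'" using flag_mono[OF G] j by auto
  then have cx: "c \<cdot> x \<in> G (j' - 1)" "c \<cdot> x \<in> G j'"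
    using x(4) lsubspaceD(3)[OF flag_lsubspace[OF G]] j by (meson less_imp_le subsetD less_le_trans)+
  have "y - c \<cdot> x \<in> G j'" using lsubspaceD(5)[OF flag_lsubspace[OF G]] y cx j by blast
  then have "y - c \<cdot> x \<in> G (j' - 1)" using c y i' by blast
  then show False using add_mem_iff(3)[OF flag_lsubspace[OF G] cx(1)] y j by simp
qed

lemma position_bij:
  fixes F G :: "nat \<Rightarrow> ('n::finite \<Rightarrow> 'k::division_ring) set"
  assumes F: "complete_flag F" and G: "complete_flag G"
  shows "bij_betw (position F G) {1..CARD('n)} {1..CARD('n)}"
proof -
  have "inj_on (position F G) {1..CARD('n)}"
    by (rule linorder_inj_onI) (use position_neq[OF F G] in auto)
  moreover have "position F G ` {1..CARD('n)} \<subseteq> {1..CARD('n)}"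
  proof
    fix i assume "i \<in> position F G ` {1..CARD('n)}"
    then obtain j where "j \<in> {1..CARD('n)}" "i = position F G j" by blast
    then show "i \<in> {1..CARD('n)}" using position_cases[OF F G] by (metis Suc_leI Suc_le_eq atLeastAtMost_iff le_add1 plus_1_eq_Suc)
  qed
  ultimately show ?thesis by (simp add: bij_betw_def endo_inj_surj)
qed

text \<open>\<open>position F G j\<close> depends only on \<open>G j\<close> and
  \<open>G (j - 1)\<close>, so a change of \<open>G k\<close> affects only the indices
  \<open>k\<close> and \<open>Suc k\<close>; bijectivity leaves the same two values for
  them.\<close>

lemma position_swap:
  fixes F G G' :: "nat \<Rightarrow> ('n::finite \<Rightarrow> 'k::division_ring) set"
  assumes F: "complete_flag F" and G: "complete_flag G" and G': "complete_flag G'"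
    and k: "1 \<le> k" "k < CARD('n)" and same: "\<And>j. j \<le> CARD('n) \<Longrightarrow> j \<noteq> k \<Longrightarrow> G j = G' j"
  shows "\<And>j. j \<in> {1..CARD('n)} \<Longrightarrow> j \<noteq> k \<Longrightarrow> j \<noteq> Suc k \<Longrightarrow> position F G' j = position F G j"
    and "{position F G' k, position F G' (Suc k)} = {position F G k, position F G (Suc k)}"
proof -
  let ?A = "{1..CARD('n)}"
  show eq: "position F G' j = position F G j" if "j \<in> ?A" "j \<noteq> k" "j \<noteq> Suc k" for j
  proof -
    have "G j = G' j" "G (j - 1) = G' (j - 1)" using same[of j] same[of "j - 1"] that by auto
    then show ?thesis unfolding position_def by simp
  qed
  have sub: "{k, Suc k} \<subseteq> ?A" using k by auto
  have compl: "position F H ` {k, Suc k} = ?A - position F H ` (?A - {k, Suc k})"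
    if "complete_flag H" for H :: "nat \<Rightarrow> ('n \<Rightarrow> 'k) set"
  proof -
    have "inj_on (position F H) ?A" "position F H ` ?A = ?A"
      using position_bij[OF F that] by (auto simp: bij_betw_def)
    then have "position F H ` (?A - {k, Suc k}) = ?A - position F H ` {k, Suc k}"
      using inj_on_image_set_diff[of "position F H" ?A ?A "{k, Suc k}"] sub by auto
    moreover have "position F H ` {k, Suc k} \<subseteq> ?A" using image_mono[OF sub] \<open>_ ` ?A = ?A\<close> by metis
    ultimately show ?thesis by blast
  qed
  have "position F G' ` (?A - {k, Suc k}) = position F G ` (?A - {k, Suc k})"
    using eq by (intro image_cong) auto
  then have "position F G' ` {k, Suc k} = position F G ` {k, Suc k}"
    using compl[OF G] compl[OF G'] by simp
  then show "{position F G' k, position F G' (Suc k)} = {position F G k, position F G (Suc k)}"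
    by simp
qed

section \<open>Chambers of projective space as complete flags\<close>

abbreviation pg_chamber :: "('n::finite \<Rightarrow> 'k::division_ring) set set \<Rightarrow> bool" where
  "pg_chamber \<equiv> chamber (CARD('n) - 1) (pg_vertices (CARD('n) - 1)) ldim pg_inc"

abbreviation pg_adjacent ::
    "('n::finite \<Rightarrow> 'k::division_ring) set set \<Rightarrow> ('n \<Rightarrow> 'k) set set \<Rightarrow> bool" where
  "pg_adjacent \<equiv> adjacent (CARD('n) - 1) (pg_vertices (CARD('n) - 1)) ldim pg_inc"

abbreviation pg_within ::
    "nat \<Rightarrow> ('n::finite \<Rightarrow> 'k::division_ring) set set \<Rightarrow> ('n \<Rightarrow> 'k) set set \<Rightarrow> bool" where
  "pg_within \<equiv> within (CARD('n) - 1) (pg_vertices (CARD('n) - 1)) ldim pg_inc"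

definition flag_chamber ::
    "(nat \<Rightarrow> ('n::finite \<Rightarrow> 'k::division_ring) set) \<Rightarrow> ('n \<Rightarrow> 'k) set set" where
  "flag_chamber F = F ` {1..CARD('n) - 1}"

lemma pg_chamber_flag_chamber:
  fixes F :: "nat \<Rightarrow> ('n::finite \<Rightarrow> 'k::division_ring) set"
  assumes "complete_flag F"
  shows "pg_chamber (flag_chamber F)"
proof -
  let ?J = "{1..CARD('n) - 1}"
  have F: "lsubspace (F i)" "ldim (F i) = i" if "i \<in> ?J" for i
    using flag_lsubspace[OF assms, of i] flag_ldim[OF assms, of i] that by auto
  have "ldim ` F ` ?J = ?J" using F(2) by (simp add: image_image cong: image_cong_simp)
  moreover have "inj_on ldim (F ` ?J)"
    by (rule inj_onI, elim imageE) (use F(2) in simp)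
  ultimately have "bij_betw ldim (F ` ?J) ?J" by (simp add: bij_betw_def)
  moreover have "pg_inc (F i) (F j)" if "i \<in> ?J" "j \<in> ?J" for i j
    unfolding pg_inc_def using flag_mono[OF assms, of i j] flag_mono[OF assms, of j i] that
    by (cases "i \<le> j") auto
  moreover have "F ` ?J \<subseteq> pg_vertices (CARD('n) - 1)"
    using F by (auto simp: pg_vertices_def)
  ultimately show ?thesis unfolding chamber_def flag_chamber_def by blast
qed

lemma pg_chamber_obtain_flag:
  fixes C :: "('n::finite \<Rightarrow> 'k::division_ring) set set"
  assumes "pg_chamber C"
  obtains F where "complete_flag F" "C = flag_chamber F"
proof -
  let ?N = "CARD('n)"
  have sub: "C \<subseteq> pg_vertices (?N - 1)" and bij: "bij_betw ldim C {1..?N - 1}"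
    and inc: "\<forall>x\<in>C. \<forall>y\<in>C. pg_inc x y" using assms unfolding chamber_def by auto
  define g where "g = inv_into C ldim"
  define F where "F i = (if i = 0 then {0} else if i = ?N then UNIV else g i)" for i
  have g: "g i \<in> C" "ldim (g i) = i" if "i \<in> {1..?N - 1}" for i
    using that bij bij_betw_inv_into_right[OF bij that]
      bij_betw_apply[OF bij_betw_inv_into[OF bij] that] unfolding g_def by auto
  obtain m where "?N = Suc m" using gr0_implies_Suc[OF zero_less_card_finite] by blast
  then have Fg: "F i = g i" if "i \<in> {1..?N - 1}" for i using that unfolding F_def by auto
  have F1: "lsubspace (F i)" "ldim (F i) = i" if le: "i \<le> ?N" for i
  proof -
    consider "i = 0" | "i = ?N" | "i \<in> {1..?N - 1}" using le by force
    then have "lsubspace (F i) \<and> ldim (F i) = i"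
    proof cases
      case 1
      then show ?thesis by (simp add: F_def lsubspace_zero ldim_zero)
    next
      case 2
      then show ?thesis by (simp add: F_def lsubspace_UNIV ldim_UNIV)
    next
      case 3
      then show ?thesis using g[OF 3] Fg[OF 3] sub by (auto simp: pg_vertices_def)
    qed
    then show "lsubspace (F i)" "ldim (F i) = i" by auto
  qed
  have F2: "F i \<subseteq> F j" if ij: "i \<le> j" "j \<le> ?N" for i j
  proof -
    consider "i = 0" | "j = ?N" | "i \<in> {1..?N - 1}" "j \<in> {1..?N - 1}" using ij by force
    then show ?thesis
    proof cases
      case 1
      then show ?thesis using lsubspaceD(1)[OF F1(1)[OF ij(2)]] by (simp add: F_def)
    next
      case 2
      then show ?thesis using ij by (simp add: F_def)
    next
      case 3
      then have "F i \<subseteq> F j \<or> F j \<subseteq> F i" using g Fg inc by (auto simp: pg_inc_def)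
      moreover have "F i = F j" if "F j \<subseteq> F i"
        using ldim_mono[of "F j" "F i"] F1[of i] F1[of j] that \<open>i \<le> j\<close> \<open>j \<le> ?N\<close> by auto
      ultimately show ?thesis by auto
    qed
  qed
  have "complete_flag F" unfolding complete_flag_def using F1 F2 by blast
  moreover have "C = flag_chamber F"
  proof -
    have "F ` {1..?N - 1} = g ` {1..?N - 1}" by (rule image_cong) (auto simp: Fg)
    also have "\<dots> = C" using bij_betw_imp_surj_on[OF bij_betw_inv_into[OF bij]] by (simp add: g_def)
    finally show ?thesis by (simp add: flag_chamber_def)
  qed
  ultimately show thesis using that by blast
qed

context
  fixes F G :: "nat \<Rightarrow> ('n::finite \<Rightarrow> 'k::division_ring) set"
  assumes F: "complete_flag F" and G: "complete_flag G"
begin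

lemma flag_chamber_Int: "flag_chamber F \<inter> flag_chamber G = F ` {i\<in>{1..CARD('n) - 1}. F i = G i}"
proof -
  let ?J = "{1..CARD('n) - 1}"
  have "y \<in> F ` {i\<in>?J. F i = G i}" if y: "y \<in> F ` ?J" "y \<in> G ` ?J" for y
  proof -
    obtain i j where ij: "i \<in> ?J" "y = F i" "j \<in> ?J" "y = G j" using y by blast
    then have "i = j" using flag_ldim[OF F, of i] flag_ldim[OF G, of j] by auto
    then have "F i = G i" using ij by simp
    then show ?thesis using ij(1,2) by blast
  qed
  then show ?thesis unfolding flag_chamber_def by auto
qed

lemma flag_inj: "inj_on F {1..CARD('n) - 1}"
proof (rule inj_onI)
  fix i j assume ij: "i \<in> {1..CARD('n) - 1}" "j \<in> {1..CARD('n) - 1}" and eq: "F i = F j"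
  have "i \<le> CARD('n)" "j \<le> CARD('n)" using ij by auto
  then have "ldim (F i) = i" "ldim (F j) = j" using flag_ldim[OF F] by blast+
  then show "i = j" using eq by metis
qed

lemma flag_ends: "F 0 = G 0" "F CARD('n) = G CARD('n)"
  using flag_zero[OF F] flag_zero[OF G] flag_top[OF F] flag_top[OF G] by simp_all

lemma flag_eqI:
  assumes "\<And>i. i \<in> {1..CARD('n) - 1} \<Longrightarrow> F i = G i" "i \<le> CARD('n)"
  shows "F i = G i"
proof -
  consider "i = 0" | "i = CARD('n)" | "i \<in> {1..CARD('n) - 1}" using assms(2) by force
  then show ?thesis by cases (use assms(1) flag_ends in auto)
qed

lemma flag_chamber_eqD:
  assumes "flag_chamber F = flag_chamber G" "i \<le> CARD('n)"
  shows "F i = G i"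
proof (rule flag_eqI)
  fix i assume "i \<in> {1..CARD('n) - 1}"
  then have "F i \<in> flag_chamber F" by (simp add: flag_chamber_def)
  then have "F i \<in> flag_chamber F \<inter> flag_chamber G" using assms(1) by simp
  then obtain j where j: "F i = F j" "F j = G j" "j \<in> {1..CARD('n) - 1}"
    unfolding flag_chamber_Int by blast
  then have "i = j" using inj_onD[OF flag_inj] \<open>i \<in> {1..CARD('n) - 1}\<close> by blast
  then show "F i = G i" using j by simp
qed (use assms in simp)

lemma pg_adjacentD:
  assumes "pg_adjacent (flag_chamber F) (flag_chamber G)"
  obtains k where "1 \<le> k" "k < CARD('n)" "\<And>i. i \<le> CARD('n) \<Longrightarrow> i \<noteq> k \<Longrightarrow> F i = G i"
proof -
  let ?J = "{1..CARD('n) - 1}" and ?E = "{i\<in>{1..CARD('n) - 1}. F i = G i}"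
  have "card (F ` ?E) + 1 = CARD('n) - 1"
    using assms flag_chamber_Int unfolding adjacent_def by simp
  moreover have "card (F ` ?E) = card ?E" by (rule card_image, rule inj_on_subset[OF flag_inj]) blast
  moreover have "card (?J - ?E) = card ?J - card ?E" by (rule card_Diff_subset) auto
  ultimately have "card (?J - ?E) = 1" by simp
  then obtain k where k: "?J - ?E = {k}" by (auto simp: card_1_singleton_iff)
  then have "k \<in> ?J" "\<And>i. i \<in> ?J \<Longrightarrow> i \<noteq> k \<Longrightarrow> F i = G i" by blast+
  moreover have "F i = G i" if i: "i \<le> CARD('n)" "i \<noteq> k" for i
  proof -
    consider "i = 0" | "i = CARD('n)" | "i \<in> ?J" using i(1) by force
    then show ?thesis by cases (use calculation(2) i(2) flag_ends in auto)
  qed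
  ultimately show thesis using that[of k] by force
qed

lemma pg_adjacentI:
  assumes k: "1 \<le> k" "k < CARD('n)" "\<And>i. i \<in> {1..CARD('n) - 1} \<Longrightarrow> i \<noteq> k \<Longrightarrow> F i = G i" "F k \<noteq> G k"
  shows "pg_adjacent (flag_chamber F) (flag_chamber G)"
proof -
  let ?J = "{1..CARD('n) - 1}" and ?E = "{i\<in>{1..CARD('n) - 1}. F i = G i}"
  have E: "?E = ?J - {k}" and "k \<in> ?J" using k by auto
  have "card (F ` ?E) = card ?E" by (rule card_image, rule inj_on_subset[OF flag_inj]) blast
  then have "card (F ` ?E) + 1 = CARD('n) - 1" unfolding E using \<open>k \<in> ?J\<close> k by simp
  moreover have "flag_chamber F \<noteq> flag_chamber G" using flag_chamber_eqD[of k] k by auto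
  ultimately show ?thesis
    unfolding adjacent_def using flag_chamber_Int pg_chamber_flag_chamber[OF F] pg_chamber_flag_chamber[OF G] by simp
qed

end

section \<open>Gallery distance as number of inversions\<close>

context
  fixes F :: "nat \<Rightarrow> ('n::finite \<Rightarrow> 'k::division_ring) set"
  assumes F: "complete_flag F"
begin

lemma position_same:
  assumes "\<And>i. i \<le> CARD('n) \<Longrightarrow> F i = G i" "j \<in> {1..CARD('n)}"
  shows "position F G j = j"
proof -
  have G: "complete_flag G" using F assms(1) unfolding complete_flag_def by simp
  obtain i x where x: "position F G j = Suc i" "x \<in> F (Suc i)" "x \<in> G j" "x \<notin> G (j - 1)" "i < CARD('n)"
    using position_cases[OF F G assms(2)] by metis
  have "\<not> Suc i \<le> j - 1"
  proof
    assume "Suc i \<le> j - 1"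
    then have "F (Suc i) \<subseteq> F (j - 1)" using flag_mono[OF F, of "Suc i" "j - 1"] assms(2)
      by (meson atLeastAtMost_iff diff_le_self order_trans)
    then show False using x assms(1)[of "j - 1"] assms(2) by auto
  qed
  moreover have "position F G j \<le> j" using position_le[of x F j G j] x assms by auto
  ultimately show ?thesis using x(1) assms(2) by auto
qed

lemma inversions_same:
  assumes "\<And>i. i \<le> CARD('n) \<Longrightarrow> F i = G i"
  shows "inversions CARD('n) (position F G) = {}"
proof -
  have "inversions CARD('n) (position F G) = inversions CARD('n) (\<lambda>j. j)"
    by (rule inversions_cong) (use position_same[OF assms] in blast)
  then show ?thesis by (simp add: inversions_def)
qed

lemma inversions_adjacent:
  assumes G: "complete_flag G" and G': "complete_flag G'"
    and adj: "pg_adjacent (flag_chamber G) (flag_chamber G')"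
  shows "card (inversions CARD('n) (position F G')) \<le> Suc (card (inversions CARD('n) (position F G)))"
proof -
  obtain k where k: "1 \<le> k" "k < CARD('n)" "\<And>i. i \<le> CARD('n) \<Longrightarrow> i \<noteq> k \<Longrightarrow> G i = G' i"
    using pg_adjacentD[OF G G' adj] by blast
  note sw = position_swap[OF F G G' k]
  let ?w = "position F G" and ?w' = "position F G'"
  have "inversions CARD('n) ?w' \<subseteq> insert (?w k, ?w (Suc k)) (inversions CARD('n) ?w)"
  proof (cases "?w' k = ?w k")
    case True
    then have "?w' (Suc k) = ?w (Suc k)" using sw(2) by (auto simp: doubleton_eq_iff)
    then have "inversions CARD('n) ?w' = inversions CARD('n) ?w"
      using True sw(1) by (intro inversions_cong) metis
    then show ?thesis by blast
  next
    case False
    then have "?w' k = ?w (Suc k)" "?w' (Suc k) = ?w k" using sw(2) by (auto simp: doubleton_eq_iff)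
    then show ?thesis using inversions_swap[OF k(1,2), of ?w' ?w] sw(1) by blast
  qed
  moreover have fin: "finite (inversions CARD('n) ?w)"
    using finite_subset[OF inversions_subset[OF position_bij[OF F G]] finite_all_pairs] .
  ultimately have "card (inversions CARD('n) ?w') \<le> card (insert (?w k, ?w (Suc k)) (inversions CARD('n) ?w))"
    by (intro card_mono) auto
  also have "\<dots> \<le> Suc (card (inversions CARD('n) ?w))" by (rule card_insert_le_m1) (use fin in auto)
  finally show ?thesis .
qed

lemma gallery_inversions:
  assumes g: "gallery (CARD('n) - 1) (pg_vertices (CARD('n) - 1)) ldim pg_inc g k" "g 0 = flag_chamber F"
  shows "i \<le> k \<Longrightarrow> complete_flag G \<Longrightarrow> g i = flag_chamber G \<Longrightarrow>
    card (inversions CARD('n) (position F G)) \<le> i"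
proof (induction i arbitrary: G)
  case 0
  then have "inversions CARD('n) (position F G) = {}"
    using inversions_same flag_chamber_eqD[OF F] g(2) by metis
  then show ?case by simp
next
  case (Suc i)
  have "pg_chamber (g i)" and adj: "pg_adjacent (g i) (g (Suc i))"
    using g Suc.prems(1) unfolding gallery_def by auto
  then obtain H where H: "complete_flag H" "g i = flag_chamber H"
    using pg_chamber_obtain_flag by blast
  then have "card (inversions CARD('n) (position F H)) \<le> i" using Suc by auto
  then show ?case using inversions_adjacent[OF H(1) Suc.prems(2)] adj H(2) Suc.prems(3) by simp
qed

text \<open>\<open>G k\<close> is replaced by \<open>G (k - 1)\<close> extended by a vector
  \<open>v\<close> of \<open>F (Suc i)\<close>, where \<open>Suc i\<close> is the position of the
  next quotient. The quotient at \<open>k\<close> now appears at step \<open>Suc i\<close> or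
  earlier, so the two values are exchanged and exactly their inversion disappears.\<close>

lemma reduce_inversions:
  assumes G: "complete_flag G" and k: "1 \<le> k" "k < CARD('n)"
    and desc: "position F G (Suc k) < position F G k"
  obtains G' where "complete_flag G'" "pg_adjacent (flag_chamber G') (flag_chamber G)"
    "card (inversions CARD('n) (position F G')) < card (inversions CARD('n) (position F G))"
proof -
  let ?N = "CARD('n)"
  obtain i v where v: "position F G (Suc k) = Suc i" "v \<in> F (Suc i)" "v \<in> G (Suc k)" "v \<notin> G k"
    using position_cases[OF F G, of "Suc k"] k
    by (metis Suc_leI atLeastAtMost_iff diff_Suc_1 le_SucI)
  obtain k' where k': "k = Suc k'" using k by (cases k) auto
  have sub: "lsubspace (G k')" "lsubspace (G (Suc k))" using flag_lsubspace[OF G] k k' by auto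
  have mono: "G k' \<subseteq> G k" "G k' \<subseteq> G (Suc k)" using flag_mono[OF G] k k' by auto
  have v': "v \<notin> G k'" using v mono by blast
  define G' where "G' = G(k := adjoin (G k') v)"
  have le: "G' k \<subseteq> G (Suc k)" using adjoin_subset_iff[OF sub] mono v by (auto simp: G'_def)
  have "complete_flag G'"
    unfolding complete_flag_def
  proof (intro conjI allI impI)
    fix i assume "i \<le> ?N"
    then show "lsubspace (G' i)"
      using flag_lsubspace[OF G] lsubspace_adjoin[OF sub(1)] by (simp add: G'_def)
    show "ldim (G' i) = i"
      using flag_ldim[OF G] ldim_adjoin[OF sub(1) v'] \<open>i \<le> ?N\<close> k k' by (auto simp: G'_def)
  next
    fix i j assume ij: "i \<le> j" "j \<le> ?N"
    consider "i = j" | "i \<noteq> k" "j \<noteq> k" | "j = k" "i \<le> k'" | "i = k" "Suc k \<le> j"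
      using ij k' by force
    then show "G' i \<subseteq> G' j"
    proof cases
      case 2
      then show ?thesis using flag_mono[OF G ij] by (simp add: G'_def)
    next
      case 3
      then have "G i \<subseteq> G k'" using flag_mono[OF G] k k' by auto
      then show ?thesis using 3 k' subset_adjoin by (auto simp: G'_def)
    next
      case 4
      then have "G (Suc k) \<subseteq> G j" using flag_mono[OF G] ij by auto
      then show ?thesis using 4 le by (auto simp: G'_def)
    qed simp
  qed
  have vk: "v \<in> G' k" using adjoin_self[OF sub(1)] by (simp add: G'_def)
  have "G' k \<noteq> G k" using vk v by blast
  then have adj: "pg_adjacent (flag_chamber G') (flag_chamber G)"
    by (intro pg_adjacentI[OF \<open>complete_flag G'\<close> G k]) (auto simp: G'_def)
  let ?w = "position F G" and ?w' = "position F G'"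
  have "\<And>j. j \<le> ?N \<Longrightarrow> j \<noteq> k \<Longrightarrow> G j = G' j" by (simp add: G'_def)
  note sw = position_swap[OF F G \<open>complete_flag G'\<close> k this]
  have "?w' k \<le> Suc i"
    using position_le[of v F "Suc i" G' k] v v' vk k' by (simp add: G'_def)
  then have "?w' k \<noteq> ?w k" using desc v(1) by simp
  then have sw': "?w' k = ?w (Suc k)" "?w' (Suc k) = ?w k" using sw(2) by (auto simp: doubleton_eq_iff)
  have inj: "inj_on ?w' {1..?N}" using position_bij[OF F \<open>complete_flag G'\<close>] bij_betw_imp_inj_on by blast
  let ?p = "(?w (Suc k), ?w k)"
  have p: "?p \<in> inversions ?N ?w" using inversionsI[of ?w "Suc k" k ?N] desc k by auto
  have "?p \<notin> inversions ?N ?w'"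
  proof
    assume "?p \<in> inversions ?N ?w'"
    then obtain j j' where j: "1 \<le> j" "j < j'" "j' \<le> ?N" "?w' k = ?w' j'" "?w' (Suc k) = ?w' j"
      unfolding inversions_def using sw' by auto
    then have "k = j'" "Suc k = j" using inj k by (auto dest: inj_onD)
    then show False using j by simp
  qed
  moreover have "inversions ?N ?w' \<subseteq> insert (?w k, ?w (Suc k)) (inversions ?N ?w)"
    using inversions_swap[OF k, of ?w' ?w] sw(1) sw' by blast
  moreover have "(?w k, ?w (Suc k)) \<notin> inversions ?N ?w'" using desc by (auto simp: inversions_def)
  ultimately have "inversions ?N ?w' \<subset> inversions ?N ?w" using p by blast
  then have "card (inversions ?N ?w') < card (inversions ?N ?w)"
    using finite_subset[OF inversions_subset[OF position_bij[OF F G]] finite_all_pairs]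
    by (intro psubset_card_mono) auto
  then show thesis using that \<open>complete_flag G'\<close> adj by blast
qed

text \<open>As long as there is a descent, one adjacency removes an inversion. Without descents the
  permutation is the identity, and this forces the two flags to coincide.\<close>

lemma within_inversions:
  "complete_flag G \<Longrightarrow>
    pg_within (card (inversions CARD('n) (position F G))) (flag_chamber F) (flag_chamber G)"
proof (induction "card (inversions CARD('n) (position F G))" arbitrary: G rule: less_induct)
  case less
  show ?case
  proof (cases "\<exists>k. 1 \<le> k \<and> k < CARD('n) \<and> position F G (Suc k) < position F G k")
    case True
    then obtain G' where G': "complete_flag G'" "pg_adjacent (flag_chamber G') (flag_chamber G)"
      "card (inversions CARD('n) (position F G')) < card (inversions CARD('n) (position F G))"
      using reduce_inversions[OF less.prems] by metis
    have "pg_within (Suc (card (inversions CARD('n) (position F G')))) (flag_chamber F) (flag_chamber G)"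
      using within_step[OF less.hyps[OF G'(3,1)]] G'(2) by blast
    then show ?thesis using G'(3) unfolding within_def by (meson Suc_leI order_trans)
  next
    case False
    then have pos: "position F G j = j" if "j \<in> {1..CARD('n)}" for j
      using ascending_bij_eq[OF position_bij[OF F less.prems] _ that] by (meson not_le)
    have eq: "F i = G i" if "i \<le> CARD('n)" for i
      using that
    proof (induction i)
      case 0
      then show ?case using flag_zero F less.prems by metis
    next
      case (Suc i)
      \<comment> \<open>Position \<open>Suc i\<close> at index \<open>Suc i\<close> gives a vector
        extending the common member \<open>F i = G i\<close> to both next members.\<close>
      obtain x where "x \<in> F (Suc i)" "x \<in> G (Suc i)" "x \<notin> G i"
        using position_cases[OF F less.prems, of "Suc i"] pos[of "Suc i"] Suc.prems by auto
      then show ?case using flag_adjoin[OF F] flag_adjoin[OF less.prems] Suc by (metis Suc_leD)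
    qed
    then have "flag_chamber F = flag_chamber G" unfolding flag_chamber_def by (intro image_cong) auto
    then show ?thesis using within_refl pg_chamber_flag_chamber[OF F] by metis
  qed
qed

text \<open>A vector new in \<open>G j\<close> cannot lie in \<open>F (CARD('n) - j)\<close>, which
  meets \<open>G j\<close> trivially. So its position is at least
  \<open>CARD('n) + 1 - j\<close>.\<close>

lemma transversal_inversions:
  assumes G: "complete_flag G"
    and trans: "\<And>i. i \<in> {1..CARD('n) - 1} \<Longrightarrow> F i \<inter> G (CARD('n) - i) \<subseteq> {0}"
  shows "inversions CARD('n) (position F G) = all_pairs CARD('n)"
proof (rule descending_bij_eq[OF position_bij[OF F G]])
  fix j assume j: "j \<in> {1..CARD('n)}"
  obtain i x where x: "position F G j = Suc i" "x \<in> F (Suc i)" "x \<in> G j" "x \<notin> G (j - 1)"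
    using position_cases[OF F G j] by metis
  show "CARD('n) + 1 - j \<le> position F G j"
  proof (rule ccontr)
    assume neg: "\<not> ?thesis"
    then have i: "Suc i \<le> CARD('n) - j" using x(1) by simp
    then have "F (Suc i) \<subseteq> F (CARD('n) - j)" using flag_mono[OF F] by simp
    moreover have "F (CARD('n) - j) \<inter> G j \<subseteq> {0}"
      using trans[of "CARD('n) - j"] i j by (simp add: diff_le_mono2)
    ultimately have "x = 0" using x by blast
    then show False using x(4) lsubspaceD(1)[OF flag_lsubspace[OF G, of "j - 1"]] j \<open>x = 0\<close>
      by (meson atLeastAtMost_iff diff_le_self order_trans)
  qed
qed

end

lemma transversal_opposite:
  fixes F G :: "nat \<Rightarrow> ('n::finite \<Rightarrow> 'k::division_ring) set"
  assumes F: "complete_flag F" and G: "complete_flag G"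
    and trans: "\<And>i. i \<in> {1..CARD('n) - 1} \<Longrightarrow> F i \<inter> G (CARD('n) - i) \<subseteq> {0}"
  shows "opposite (CARD('n) - 1) (pg_vertices (CARD('n) - 1)) ldim pg_inc
    (flag_chamber F) (flag_chamber G)"
proof -
  let ?d = "gdist (CARD('n) - 1) (pg_vertices (CARD('n) - 1)) (ldim :: ('n \<Rightarrow> 'k) set \<Rightarrow> nat) pg_inc"
  have "card (all_pairs CARD('n)) \<le> ?d (flag_chamber F) (flag_chamber G)"
  proof (rule gdist_ge[OF within_inversions[OF F G]])
    fix g j assume "gallery (CARD('n) - 1) (pg_vertices (CARD('n) - 1)) ldim pg_inc g j"
      "g 0 = flag_chamber F" "g j = flag_chamber G"
    then show "card (all_pairs CARD('n)) \<le> j"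
      using gallery_inversions[OF F _ _ order_refl G] transversal_inversions[OF F G trans] by force
  qed
  moreover have "?d C D \<le> card (all_pairs CARD('n))" if CD: "pg_chamber C" "pg_chamber D" for C D
  proof -
    obtain F' G' :: "nat \<Rightarrow> ('n \<Rightarrow> 'k) set" where *: "complete_flag F'" "C = flag_chamber F'"
      "complete_flag G'" "D = flag_chamber G'" using pg_chamber_obtain_flag CD by metis
    then have "?d C D \<le> card (inversions CARD('n) (position F' G'))"
      using gdist_le within_inversions by blast
    also have "\<dots> \<le> card (all_pairs CARD('n))"
      using inversions_subset[OF position_bij] * finite_all_pairs card_mono by metis
    finally show ?thesis .
  qed
  ultimately show ?thesis
    unfolding opposite_def using pg_chamber_flag_chamber F G order_trans by blast
qed

subsection \<open>Absolute points of a duality\<close>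

text \<open>Abstract form of orthogonality under a duality, without symmetry. \<open>codim\<close>
  says that the right polar of a vector is a hyperplane or everything; \<open>separation\<close>
  says that a subspace is the left polar of its right polar.\<close>

locale dual_relation =
  fixes R :: "('n::finite \<Rightarrow> 'k::division_ring) \<Rightarrow> ('n \<Rightarrow> 'k) \<Rightarrow> bool"
  assumes right: "lsubspace {y. R x y}"
    and left: "lsubspace {x. R x y}"
    and codim: "\<not> R x y \<Longrightarrow> \<exists>c. R x (z - c \<cdot> y)"
    and separation: "lsubspace U \<Longrightarrow> (\<And>y. \<forall>u\<in>U. R u y \<Longrightarrow> R h y) \<Longrightarrow> h \<in> U"
begin

lemma zero_right: "R x 0" and smul_right: "R x y \<Longrightarrow> R x (c \<cdot> y)"
  using lsubspaceD(1,3)[OF right[of x]] by auto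

lemma add_right_iff: "R x y \<Longrightarrow> R x (y + z) \<longleftrightarrow> R x z" "R x y \<Longrightarrow> R x (z + y) \<longleftrightarrow> R x z"
    "R x y \<Longrightarrow> R x (z - y) \<longleftrightarrow> R x z"
  using add_mem_iff[OF right[of x]] by auto

lemma smul_right_iff: "c \<noteq> 0 \<Longrightarrow> R x (c \<cdot> y) \<longleftrightarrow> R x y"
  using smul_mem_iff[OF right[of x], of c y] by simp

lemma zero_left: "R 0 y" and smul_left: "R x y \<Longrightarrow> R (c \<cdot> x) y"
  using lsubspaceD(1,3)[OF left[of y]] by auto

lemma add_left_iff: "R x y \<Longrightarrow> R (x + z) y \<longleftrightarrow> R z y" "R x y \<Longrightarrow> R (z + x) y \<longleftrightarrow> R z y"
    "R x y \<Longrightarrow> R (z - x) y \<longleftrightarrow> R z y"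
  using add_mem_iff[OF left[of y]] by auto

lemma smul_left_iff: "c \<noteq> 0 \<Longrightarrow> R (c \<cdot> x) y \<longleftrightarrow> R x y"
  using smul_mem_iff[OF left[of y], of c x] by simp

definition perp :: "('n \<Rightarrow> 'k) set \<Rightarrow> ('n \<Rightarrow> 'k) set"
  where "perp U = {y. \<forall>u\<in>U. R u y}"

lemma lsubspace_perp: "lsubspace (perp U)"
  unfolding perp_def lsubspace_iff using zero_right smul_right add_right_iff(1) by blast

lemma perp_adjoin:
  assumes "lsubspace U"
  shows "y \<in> perp (adjoin U x) \<longleftrightarrow> y \<in> perp U \<and> R x y"
  using adjoin_subset_iff[OF assms left[of y], of x] by (auto simp: perp_def)

text \<open>The subspaces \<open>U\<close> that are the end of a flag all of whose members meet their polar
  trivially.\<close>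
inductive transversal :: "('n \<Rightarrow> 'k) set \<Rightarrow> bool" where
  zero: "transversal {0}"
| adjoin: "transversal U \<Longrightarrow> x \<in> perp U \<Longrightarrow> \<not> R x x \<Longrightarrow> transversal (adjoin U x)"

lemma transversal_lsubspace: "transversal U \<Longrightarrow> lsubspace U"
  by (induction rule: transversal.induct) (auto intro: lsubspace_zero lsubspace_adjoin)

lemma transversal_Int: "transversal U \<Longrightarrow> U \<inter> perp U = {0}"
proof (induction rule: transversal.induct)
  case zero
  then show ?case using zero_right by (auto simp: perp_def)
next
  case (adjoin U x)
  note U = transversal_lsubspace[OF adjoin.hyps(1)]
  have "y = 0" if y: "y \<in> adjoin U x" "y \<in> perp (adjoin U x)" for y
  proof -
    obtain c where c: "y - c \<cdot> x \<in> U" using y(1) by (auto simp: adjoin_def)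
    have y': "y \<in> perp U" "R x y" using y(2) perp_adjoin[OF U] by auto
    then have "y - c \<cdot> x \<in> perp U"
      using lsubspaceD(5)[OF lsubspace_perp] lsubspaceD(3)[OF lsubspace_perp] adjoin.hyps(2) by blast
    then have "y - c \<cdot> x = 0" using c adjoin.IH by blast
    then have yc: "y = c \<cdot> x" by simp
    then have "c = 0" using y'(2) smul_right_iff[of c x x] adjoin.hyps(3) by blast
    then show ?thesis using yc by simp
  qed
  moreover have "0 \<in> adjoin U x" "0 \<in> perp (adjoin U x)"
    using lsubspaceD(1)[OF lsubspace_adjoin[OF U]] lsubspaceD(1)[OF lsubspace_perp] by blast+
  ultimately show ?case by blast
qed

lemma transversal_ldim_adjoin:
  assumes "transversal U" "x \<in> perp U" "\<not> R x x"
  shows "ldim (adjoin U x) = Suc (ldim U)"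
proof (rule ldim_adjoin[OF transversal_lsubspace[OF assms(1)]])
  show "x \<notin> U"
  proof
    assume "x \<in> U"
    then have "x = 0" using transversal_Int[OF assms(1)] assms(2) by blast
    then show False using assms(3) zero_left by blast
  qed
qed

lemma transversal_filtration:
  "transversal U \<Longrightarrow> \<exists>F. F (ldim U) = U \<and> (\<forall>i\<le>ldim U. transversal (F i) \<and> ldim (F i) = i) \<and>
    (\<forall>i j. i \<le> j \<longrightarrow> j \<le> ldim U \<longrightarrow> F i \<subseteq> F j)"
proof (induction rule: transversal.induct)
  case zero
  then show ?case by (intro exI[of _ "\<lambda>_. {0}"]) (simp add: ldim_zero transversal.zero)
next
  case (adjoin U x)
  then obtain F where F: "F (ldim U) = U" "\<And>i. i \<le> ldim U \<Longrightarrow> transversal (F i) \<and> ldim (F i) = i"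
    "\<And>i j. i \<le> j \<Longrightarrow> j \<le> ldim U \<Longrightarrow> F i \<subseteq> F j" by blast
  let ?G = "F(Suc (ldim U) := adjoin U x)"
  note dim = transversal_ldim_adjoin[OF adjoin.hyps]
  have "?G i \<subseteq> ?G j" if ij: "i \<le> j" "j \<le> Suc (ldim U)" for i j
  proof (cases "j = Suc (ldim U) \<and> i \<noteq> j")
    case True
    then have "F i \<subseteq> U" using F(1) F(3)[of i "ldim U"] ij by auto
    then show ?thesis using True subset_adjoin by fastforce
  next
    case False
    then show ?thesis using F(3)[of i j] ij by auto
  qed
  moreover have "transversal (?G i) \<and> ldim (?G i) = i" if "i \<le> Suc (ldim U)" for i
    using that F(2)[of i] dim transversal.adjoin[OF adjoin.hyps] by auto
  ultimately show ?case using dim by (intro exI[of _ ?G]) auto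
qed

lemma transversal_complete_flag:
  assumes "transversal UNIV"
  obtains F where "complete_flag F" "\<And>i. i \<le> CARD('n) \<Longrightarrow> F i \<inter> perp (F i) = {0}"
proof -
  obtain F where "\<forall>i\<le>CARD('n). transversal (F i) \<and> ldim (F i) = i"
    "\<forall>i j. i \<le> j \<longrightarrow> j \<le> CARD('n) \<longrightarrow> F i \<subseteq> F j"
    using transversal_filtration[OF assms] ldim_UNIV[where 'n='n and 'k='k] by auto
  then show thesis
    using that[of F] transversal_lsubspace transversal_Int unfolding complete_flag_def by blast
qed

text \<open>A non-absolute \<open>z\<close> in the polar of \<open>y\<close> would allow
  \<open>U\<close> to be extended twice, by \<open>y\<close> and then by \<open>z\<close>, beyond
  the maximal dimension.\<close>

lemma nonabsolute_polar:
  assumes max: "\<And>V. transversal V \<Longrightarrow> ldim V \<le> Suc (ldim U)" and U: "transversal U"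
    and y: "y \<in> perp U" "\<not> R y y" and z: "z \<in> perp U" "R y z"
  shows "R z z"
proof (rule ccontr)
  assume nz: "\<not> R z z"
  have V: "transversal (adjoin U y)" by (rule transversal.adjoin[OF U y])
  have "z \<in> perp (adjoin U y)" using perp_adjoin[OF transversal_lsubspace[OF U]] z by blast
  then have "ldim (adjoin (adjoin U y) z) = Suc (Suc (ldim U))"
    "transversal (adjoin (adjoin U y) z)"
    using transversal_ldim_adjoin[OF V _ nz] transversal_ldim_adjoin[OF U y]
      transversal.adjoin[OF V _ nz] by auto
  then show False using max by fastforce
qed

text \<open>The right polar of the non-absolute point \<open>x + c \<cdot> h\<close> contains
  \<open>h\<close> and, for a suitable \<open>d\<close>, \<open>x - d \<cdot> h'\<close>, hence
  every \<open>x - d \<cdot> h' + e \<cdot> h\<close>. These are absolute by \<open>polar\<close>,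
  which makes them left orthogonal to \<open>x\<close>; subtracting the cases \<open>e = 0\<close>
  and \<open>e = 1\<close> isolates \<open>h\<close>.\<close>

lemma polar_of_perturbed_point:
  assumes W: "lsubspace W"
    and polar: "\<And>y z. y \<in> W \<Longrightarrow> \<not> R y y \<Longrightarrow> z \<in> W \<Longrightarrow> R y z \<Longrightarrow> R z z"
    and x: "x \<in> W" "\<not> R x x"
    and h: "h \<in> W" "R x h" and h': "h' \<in> W" "R x h'" "\<not> R h h'"
    and c: "c \<noteq> 0" "\<not> R (x + c \<cdot> h) x"
  shows "R h x \<and> (\<exists>d. R (x - d \<cdot> h') x)"
proof -
  note W' = lsubspaceD[OF W]
  let ?y = "x + c \<cdot> h"
  have hh: "R h h" by (rule polar[OF x h])
  have yh: "R ?y h" using add_left_iff(1)[OF h(2)] smul_left[OF hh] by blast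
  have yW: "?y \<in> W" using W'(2)[OF x(1) W'(3)[OF h(1)]] .
  \<comment> \<open>Since \<open>R ?y h\<close>, the statement \<open>R ?y ?y\<close> reduces to
    \<open>R ?y x\<close>.\<close>
  have yy: "\<not> R ?y ?y" using c(2) add_right_iff(2)[OF smul_right[OF yh, of c], of x] by blast
  have "\<not> R ?y h'" using add_left_iff(1)[OF h'(2)] smul_left_iff[OF c(1)] h'(3) by blast
  then obtain d where d: "R ?y (x - d \<cdot> h')" using codim by blast
  \<comment> \<open>\<open>x + ?g\<close> is absolute as it lies in the polar of \<open>?y\<close>,
    and \<open>?g\<close> as it lies in the polar of \<open>x\<close>. Removing \<open>?g\<close>
    from the right argument leaves \<open>x\<close>.\<close>
  have abs: "R (x + (e \<cdot> h - d \<cdot> h')) x" for e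
  proof -
    let ?g = "e \<cdot> h - d \<cdot> h'"
    have g: "?g \<in> W" "R x ?g"
      using W'(5)[OF W'(3)[OF h(1)] W'(3)[OF h'(1)]]
        add_right_iff(3)[OF smul_right[OF h'(2)]] smul_right[OF h(2)] by blast+
    have gg: "R ?g ?g" by (rule polar[OF x g])
    have "x + ?g = (x - d \<cdot> h') + e \<cdot> h" by simp
    then have "R ?y (x + ?g)" using d add_right_iff(2)[OF smul_right[OF yh, of e]] by metis
    then have zz: "R (x + ?g) (x + ?g)" using polar[OF yW yy] W'(2)[OF x(1) g(1)] by blast
    have "R (x + ?g) ?g" using add_left_iff(1)[OF g(2)] gg by blast
    then show ?thesis using zz add_right_iff(2) by blast
  qed
  have d0: "R (x - d \<cdot> h') x" using abs[of 0] by simp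
  moreover have "R ((x - d \<cdot> h') + h) x" using abs[of 1] by (simp add: algebra_simps)
  ultimately show ?thesis using add_left_iff(1)[OF d0] by blast
qed

text \<open>Let \<open>U + \<langle>p\<rangle>\<close> be transversal of maximal dimension and work inside \<open>perp U\<close>. By maximality
  the polar of any non-absolute point consists of absolute points. Perturbing \<open>p\<close> along \<open>h\<close> in
  its polar, which is possible as there is a third scalar \<open>a\<close>, shows that the polar of \<open>p\<close> is also
  left orthogonal to \<open>p\<close>; a second perturbation then makes \<open>p\<close> absolute.\<close>
theorem all_absolute:
  assumes ntrans: "\<not> transversal UNIV" and a: "a \<noteq> 0" "a \<noteq> (1::'k)"
  shows "R x x"
proof (rule ccontr)
  assume x0: "\<not> R x x"
  have "\<exists>V. transversal V \<and> (\<forall>V'. transversal V' \<longrightarrow> ldim V' \<le> ldim V)"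
    using ex_has_greatest_nat[of transversal "{0}" ldim "Suc CARD('n)"]
      transversal.zero transversal_lsubspace ldim_le(1) le_imp_less_Suc by blast
  then obtain V where V: "transversal V" and max: "\<And>V'. transversal V' \<Longrightarrow> ldim V' \<le> ldim V" by blast
  from V show False
  proof cases
    case zero
    have "x \<in> perp {0}" using zero_left by (auto simp: perp_def)
    then have "ldim (adjoin {0} x) = Suc (ldim V)" "transversal (adjoin {0} x)"
      using transversal_ldim_adjoin[OF transversal.zero _ x0] transversal.adjoin[OF transversal.zero _ x0] zero
      by auto
    then show False using max by fastforce
  next
    case (adjoin U p)
    note U = adjoin(2) and p = adjoin(3,4)
    note subU = transversal_lsubspace[OF U]
    have dimV: "ldim V = Suc (ldim U)" using transversal_ldim_adjoin[OF U p] adjoin(1) by simp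
    let ?W = "perp U"
    have polar: "R z z" if "y \<in> ?W" "\<not> R y y" "z \<in> ?W" "R y z" for y z
      using nonabsolute_polar[OF _ U that] max dimV by simp
    have H: "y \<in> perp V \<longleftrightarrow> y \<in> ?W \<and> R p y" for y using perp_adjoin[OF subU] adjoin(1) by simp
    have ex: "\<exists>h'. h' \<in> ?W \<and> R p h' \<and> \<not> R h h'" if "h \<notin> V" for h
    proof (rule ccontr)
      assume "\<not> ?thesis"
      then have "R h y" if "\<forall>u\<in>V. R u y" for y using H[of y] that by (auto simp: perp_def)
      then show False using separation[OF transversal_lsubspace[OF V]] \<open>h \<notin> V\<close> by blast
    qed
    \<comment> \<open>Such an \<open>h\<close> lies in \<open>perp V\<close>, which meets
      \<open>V\<close> only in 0, so \<open>ex\<close> applies.\<close>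
    have ex': "\<exists>h'. h' \<in> ?W \<and> R p h' \<and> \<not> R h h'" if "h \<in> ?W" "R p h" "h \<noteq> 0" for h
      using ex H transversal_Int[OF V] that by blast
    have "V \<noteq> UNIV" using ntrans V by metis
    then obtain q where "q \<notin> V" by blast
    then obtain h where h: "h \<in> ?W" "R p h" "h \<noteq> 0" using ex[of q] zero_right by metis
    have key: "R h p \<and> (\<exists>d. R (p - d \<cdot> h') p)"
      if "h \<in> ?W" "R p h" "h' \<in> ?W" "R p h'" "\<not> R h h'" "c \<noteq> 0" "\<not> R (p + c \<cdot> h) p" for h h' c
      by (rule polar_of_perturbed_point[OF lsubspace_perp _ p that]) (rule polar)
    have hp: "R h p" if h: "h \<in> ?W" "R p h" "h \<noteq> 0" for h
    proof (rule ccontr)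
      assume n: "\<not> R h p"
      obtain h' where h': "h' \<in> ?W" "R p h'" "\<not> R h h'" using ex'[OF h] by blast
      \<comment> \<open>Otherwise \<open>key\<close> would give \<open>R h p\<close>. The values
        \<open>c = 1\<close> and \<open>c = a\<close> then yield \<open>R h p\<close> by subtraction
        after all.\<close>
      have "R (p + c \<cdot> h) p" if "c \<noteq> 0" for c using key[OF h(1,2) h' that] n by blast
      from this[of 1] this[of a] have "R (p + h) p" "R (p + a \<cdot> h) p" using a by auto
      then have "R ((p + a \<cdot> h) - (p + h)) p" using add_left_iff(3) by blast
      then have "R ((a - 1) \<cdot> h) p" by (simp add: smul_algebra)
      then show False using n smul_left_iff[of "a - 1"] a by simp
    qed
    obtain h' where h': "h' \<in> ?W" "R p h'" "\<not> R h h'" using ex'[OF h] by blast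
    have "h' \<noteq> 0" using h'(3) zero_right by blast
    \<comment> \<open>With \<open>R h p\<close> known, perturbing by \<open>h\<close> cannot make
      \<open>p\<close> left orthogonal to itself, so \<open>key\<close> now applies. Its second
      conclusion, together with \<open>R h' p\<close>, gives \<open>R p p\<close>.\<close>
    have "\<not> R (p + 1 \<cdot> h) p" using add_left_iff(2)[OF hp[OF h]] p by simp
    then obtain d where "R (p - d \<cdot> h') p" using key[OF h(1,2) h', of 1] by auto
    then show False using add_left_iff(3)[OF smul_left[OF hp[OF h'(1,2) \<open>h' \<noteq> 0\<close>]]] p by blast
  qed
qed

end

subsection \<open>Null polarities and alternating forms\<close>

definition left_linear :: "(('n \<Rightarrow> 'k::division_ring) \<Rightarrow> 'k) \<Rightarrow> bool"
  where "left_linear \<psi> \<longleftrightarrow> (\<forall>x y. \<psi> (x + y) = \<psi> x + \<psi> y) \<and> (\<forall>c x. \<psi> (c \<cdot> x) = c * \<psi> x)"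

lemma left_linearD:
  assumes "left_linear \<psi>"
  shows "\<psi> (x + y) = \<psi> x + \<psi> y" "\<psi> (x - y) = \<psi> x - \<psi> y" "\<psi> (c \<cdot> x) = c * \<psi> x" "\<psi> 0 = 0"
proof -
  show 1: "\<psi> (x + y) = \<psi> x + \<psi> y" for x y using assms by (simp add: left_linear_def)
  show "\<psi> (c \<cdot> x) = c * \<psi> x" for c using assms by (simp add: left_linear_def)
  show "\<psi> (x - y) = \<psi> x - \<psi> y" using 1[of "x - y" y] by (simp add: algebra_simps)
  show "\<psi> 0 = 0" using 1[of 0 0] by simp
qed

lemma left_linear_add: "left_linear \<psi> \<Longrightarrow> left_linear \<chi> \<Longrightarrow> left_linear (\<lambda>v. \<psi> v + \<chi> v)"
  and left_linear_diff: "left_linear \<psi> \<Longrightarrow> left_linear \<chi> \<Longrightarrow> left_linear (\<lambda>v. \<psi> v - \<chi> v)"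
  by (simp_all add: left_linear_def algebra_simps)

locale null_relation = dual_relation R
  for R :: "('n::finite \<Rightarrow> 'k::division_ring) \<Rightarrow> ('n \<Rightarrow> 'k) \<Rightarrow> bool" +
  assumes absolute: "R x x"
begin

text \<open>Expand the absoluteness of \<open>x + y\<close>: all terms but \<open>R y x\<close> are
  known.\<close>

lemma sym: "R x y \<Longrightarrow> R y x"
proof -
  assume xy: "R x y"
  have "R (x + y) y" using add_left_iff(1)[OF xy] absolute by blast
  then have "R (x + y) x" using absolute[of "x + y"] add_right_iff(2) by blast
  then show "R y x" using add_left_iff(1)[OF absolute] by blast
qed

lemma sym_iff: "R x y \<longleftrightarrow> R y x"
  using sym by blast

text \<open>A maximal totally isotropic subspace equals its own polar.\<close>
lemma even_dim:
  assumes dim: "\<And>U. lsubspace U \<Longrightarrow> ldim U + ldim (perp U) = CARD('n)"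
  shows "even CARD('n)"
proof -
  let ?P = "\<lambda>U. lsubspace U \<and> U \<subseteq> perp U"
  have "?P {0}" using lsubspace_zero zero_left by (auto simp: perp_def)
  then obtain U where U: "?P U" and max: "\<And>V. ?P V \<Longrightarrow> ldim V \<le> ldim U"
    using ex_has_greatest_nat[of ?P "{0}" ldim "Suc CARD('n)"] ldim_le(1) le_imp_less_Suc by blast
  have "perp U \<subseteq> U"
  proof (rule ccontr)
    assume "\<not> ?thesis"
    then obtain x where x: "x \<in> perp U" "x \<notin> U" by blast
    note aU = lsubspace_adjoin[OF conjunct1[OF U], of x]
    have "U \<subseteq> perp (adjoin U x)" "x \<in> perp (adjoin U x)"
      using perp_adjoin[OF conjunct1[OF U]] U x sym absolute by (auto simp: perp_def)
    then have "adjoin U x \<subseteq> perp (adjoin U x)"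
      using adjoin_subset_iff[OF conjunct1[OF U] lsubspace_perp] by blast
    then have "ldim (adjoin U x) \<le> ldim U" using max aU by blast
    then show False using ldim_adjoin[OF conjunct1[OF U] x(2)] by simp
  qed
  then have "perp U = U" using U by blast
  then have "CARD('n) = 2 * ldim U" using dim[OF conjunct1[OF U]] by simp
  then show ?thesis by simp
qed

text \<open>\<open>\<psi> v\<close> is the coefficient of \<open>v\<close> along \<open>a\<close>
  modulo the polar hyperplane of \<open>x\<close>; it exists by \<open>codim\<close> and is unique
  because \<open>a\<close> is outside the hyperplane.\<close>

lemma functional_ex:
  assumes a: "\<not> R x a"
  obtains \<psi> where "left_linear \<psi>" "\<And>v. \<psi> v = 0 \<longleftrightarrow> R x v" "\<psi> a = 1"
proof -
  define \<psi> where "\<psi> v = (THE c. R x (v - c \<cdot> a))" for v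
  have uniq: "c = d" if "R x (v - c \<cdot> a)" "R x (v - d \<cdot> a)" for c d v
  proof -
    have "R x ((v - c \<cdot> a) - (v - d \<cdot> a))" using add_right_iff(3)[OF that(2)] that(1) by blast
    then have "R x ((d - c) \<cdot> a)" by (simp add: smul_algebra)
    then show ?thesis using smul_right_iff[of "d - c" x a] a by auto
  qed
  have eq: "\<psi> v = c" if "R x (v - c \<cdot> a)" for v c
    unfolding \<psi>_def using that uniq by blast
  have \<psi>: "R x (v - \<psi> v \<cdot> a)" for v using codim[OF a, of v] eq by metis
  have "left_linear \<psi>" unfolding left_linear_def
  proof (intro conjI allI)
    fix v w c
    have "R x ((v - \<psi> v \<cdot> a) + (w - \<psi> w \<cdot> a))" using add_right_iff(1) \<psi> by blast
    then show "\<psi> (v + w) = \<psi> v + \<psi> w" by (intro eq) (simp add: smul_algebra algebra_simps)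
    have "R x (c \<cdot> (v - \<psi> v \<cdot> a))" using smul_right \<psi> by blast
    then show "\<psi> (c \<cdot> v) = c * \<psi> v" by (intro eq) (simp add: smul_algebra)
  qed
  moreover have "\<psi> v = 0 \<longleftrightarrow> R x v" for v using eq[of v 0] \<psi>[of v] by auto
  moreover have "\<psi> a = 1" using eq[of a 1] zero_right by simp
  ultimately show thesis using that by blast
qed

lemma lsubspace_ray: "lsubspace (adjoin {0} x)"
  by (rule lsubspace_adjoin[OF lsubspace_zero])

lemma separate_ray:
  assumes "z \<notin> adjoin {0} x"
  obtains a where "R x a" "\<not> R z a"
proof -
  have "\<exists>a. (\<forall>u\<in>adjoin {0} x. R u a) \<and> \<not> R z a"
    using separation[OF lsubspace_ray] assms by blast
  then show thesis using that adjoin_self[OF lsubspace_zero] by blast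
qed

lemma separate_plane:
  assumes "z \<notin> adjoin (adjoin {0} x) y"
  obtains a where "R x a" "R y a" "\<not> R z a"
proof -
  have "\<exists>a. (\<forall>u\<in>adjoin (adjoin {0} x) y. R u a) \<and> \<not> R z a"
    using separation[OF lsubspace_adjoin[OF lsubspace_ray]] assms by blast
  then show thesis using that adjoin_self[OF lsubspace_zero] adjoin_self[OF lsubspace_ray]
      subset_adjoin by blast
qed

text \<open>A functional with kernel the polar of \<open>y\<close> is unique up to a right factor. For \<open>y \<notin> \<langle>e\<rangle>\<close> this
  factor is fixed by the condition on \<open>e + y\<close>, which makes the choice additive in \<open>y\<close>.\<close>
definition normalized :: "('n \<Rightarrow> 'k) \<Rightarrow> (('n \<Rightarrow> 'k) \<Rightarrow> 'k) \<Rightarrow> ('n \<Rightarrow> 'k) \<Rightarrow> (('n \<Rightarrow> 'k) \<Rightarrow> 'k) \<Rightarrow> bool"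
  where "normalized e \<phi> y \<psi> \<longleftrightarrow> left_linear \<psi> \<and> (\<forall>v. \<psi> v = 0 \<longleftrightarrow> R y v) \<and> (\<forall>v. \<phi> v + \<psi> v = 0 \<longleftrightarrow> R (e + y) v)"

context
  fixes e \<phi>
  assumes e: "e \<noteq> 0" and \<phi>: "left_linear \<phi>" "\<And>v. \<phi> v = 0 \<longleftrightarrow> R e v"
begin

lemma dual_vector: "\<not> R z a \<Longrightarrow> left_linear \<psi> \<Longrightarrow> (\<And>v. \<psi> v = 0 \<longleftrightarrow> R z v) \<Longrightarrow>
    \<exists>k. k \<noteq> 0 \<and> \<psi> (k \<cdot> a) = 1"
  by (rule exI[of _ "inverse (\<psi> a)"]) (simp add: left_linearD)

lemma not_ray_sym: "y \<notin> adjoin {0} e \<Longrightarrow> e \<notin> adjoin {0} y"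
proof
  assume y: "y \<notin> adjoin {0} e" and "e \<in> adjoin {0} y"
  then have "adjoin {0} e = adjoin {0} y" using adjoin_exchange[OF lsubspace_zero, of e y] e by blast
  then show False using y adjoin_self[OF lsubspace_zero] by blast
qed

text \<open>Take \<open>a\<close> in the polar of \<open>y\<close> with \<open>\<phi> a = 1\<close>
  and \<open>b\<close> in the polar of \<open>e\<close> only. The polar of \<open>e + y\<close>
  contains some \<open>a - k \<cdot> b\<close>, and \<open>\<phi> + \<psi>\<close> vanishes there
  exactly when \<open>\<psi> (k \<cdot> b) = 1\<close>. The remainder \<open>?r\<close> lies in both
  polars, hence in that of \<open>e + y\<close>.\<close>

lemma normalized_ex:
  assumes y: "y \<notin> adjoin {0} e"
  shows "\<exists>\<psi>. normalized e \<phi> y \<psi>"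
proof -
  obtain b where b: "R e b" "\<not> R y b" using separate_ray[OF y] by blast
  obtain a' where a': "R y a'" "\<not> R e a'" using separate_ray[OF not_ray_sym[OF y]] by blast
  obtain k' where "k' \<noteq> 0" and k': "\<phi> (k' \<cdot> a') = 1" using dual_vector[OF a'(2) \<phi>] by blast
  define a where "a = k' \<cdot> a'"
  have a: "R y a" "\<phi> a = 1" "\<not> R e a" using k' a'(1) smul_right \<phi>(2)[of a] by (auto simp: a_def)
  have nb: "\<not> R (e + y) b" using add_left_iff(1)[OF b(1)] b(2) by blast
  have na: "\<not> R (e + y) a" using add_left_iff(2)[OF a(1)] a(3) by blast
  obtain k where k: "R (e + y) (a - k \<cdot> b)" using codim[OF nb] by blast
  have "k \<noteq> 0" using k na by auto
  have nkb: "\<not> R y (k \<cdot> b)" using smul_right_iff[OF \<open>k \<noteq> 0\<close>] b(2) by blast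
  obtain \<psi> where \<psi>: "left_linear \<psi>" "\<And>v. \<psi> v = 0 \<longleftrightarrow> R y v" "\<psi> (k \<cdot> b) = 1"
    using functional_ex[OF nkb] by blast
  have kb: "R e (k \<cdot> b)" using b(1) smul_right by blast
  have "\<phi> v + \<psi> v = 0 \<longleftrightarrow> R (e + y) v" for v
  proof -
    let ?r = "v - \<phi> v \<cdot> a - \<psi> v \<cdot> k \<cdot> b"
    have "\<phi> b = 0" "\<psi> a = 0" "k * \<psi> b = 1"
      using \<phi>(2) \<psi>(2,3) a(1) b(1) left_linearD(3)[OF \<psi>(1)] by auto
    then have "\<phi> ?r = 0" "\<psi> ?r = 0"
      using a(2) by (simp_all add: left_linearD[OF \<phi>(1)] left_linearD[OF \<psi>(1)])
    then have "R (e + y) ?r" using \<phi>(2) \<psi>(2) add_left_iff(1) by blast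
    moreover have "v = ?r + (\<phi> v + \<psi> v) \<cdot> a - \<psi> v \<cdot> (a - k \<cdot> b)"
      by (simp add: smul_algebra algebra_simps)
    ultimately have "R (e + y) v \<longleftrightarrow> R (e + y) ((\<phi> v + \<psi> v) \<cdot> a)"
      using add_right_iff smul_right[OF k] by metis
    then show ?thesis using smul_right_iff[of "\<phi> v + \<psi> v"] na zero_right by (cases "\<phi> v + \<psi> v = 0") auto
  qed
  then show ?thesis unfolding normalized_def using \<psi> by blast
qed

text \<open>Functionals with the same kernel agree once they agree at one vector \<open>b\<close>
  outside it. As \<open>a - b\<close> is killed by \<open>\<phi> + \<psi>\<close>, it lies in the
  polar of \<open>e + y\<close>; evaluating \<open>\<phi> + \<chi>\<close> there gives
  \<open>\<chi> b = 1\<close>.\<close>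

lemma normalized_unique:
  assumes y: "y \<notin> adjoin {0} e" and \<psi>: "normalized e \<phi> y \<psi>" and \<chi>: "normalized e \<phi> y \<chi>"
  shows "\<psi> = \<chi>"
proof
  fix v
  obtain b' where b': "R e b'" "\<not> R y b'" using separate_ray[OF y] by blast
  obtain a' where a': "R y a'" "\<not> R e a'" using separate_ray[OF not_ray_sym[OF y]] by blast
  have lin: "left_linear \<psi>" "left_linear \<chi>" and ker: "\<And>v. \<psi> v = 0 \<longleftrightarrow> R y v" "\<And>v. \<chi> v = 0 \<longleftrightarrow> R y v"
    and ker': "\<And>v. \<phi> v + \<psi> v = 0 \<longleftrightarrow> R (e + y) v" "\<And>v. \<phi> v + \<chi> v = 0 \<longleftrightarrow> R (e + y) v"
    using \<psi> \<chi> unfolding normalized_def by blast+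
  obtain k l where k: "\<phi> (k \<cdot> a') = 1" and l: "\<psi> (l \<cdot> b') = 1"
    using dual_vector[OF a'(2) \<phi>] dual_vector[OF b'(2) lin(1) ker(1)] by metis
  define a b where "a = k \<cdot> a'" and "b = l \<cdot> b'"
  have ab: "\<phi> a = 1" "\<psi> a = 0" "\<chi> a = 0" "\<phi> b = 0" "\<psi> b = 1"
    using k l smul_right[OF a'(1)] smul_right[OF b'(1)] \<phi>(2) ker by (auto simp: a_def b_def)
  have "\<phi> (a - b) + \<psi> (a - b) = 0" using ab by (simp add: left_linearD[OF \<phi>(1)] left_linearD[OF lin(1)])
  then have "\<phi> (a - b) + \<chi> (a - b) = 0" using ker' by simp
  then have "\<chi> b = 1" using ab by (simp add: left_linearD[OF \<phi>(1)] left_linearD[OF lin(2)])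
  have "\<psi> (v - \<psi> v \<cdot> b) = 0" using ab by (simp add: left_linearD[OF lin(1)])
  then have "\<chi> (v - \<psi> v \<cdot> b) = 0" using ker by simp
  then show "\<psi> v = \<chi> v" using \<open>\<chi> b = 1\<close> by (simp add: left_linearD[OF lin(2)])
qed

text \<open>The vectors \<open>a\<close>, \<open>b\<close>, \<open>c\<close> are dual to
  \<open>\<phi>\<close>, \<open>\<psi>\<close>, \<open>\<chi>\<close>. Both \<open>a - b\<close> and
  \<open>a - c\<close> lie in the polar of \<open>e + y + z\<close>; hence so does
  \<open>b - c\<close>, which is also in the polar of \<open>e\<close> and thus in that of
  \<open>y + z\<close>. Modulo the common kernel these vectors determine the two hyperplanes in
  question.\<close>

lemma normalized_add:
  assumes y: "y \<notin> adjoin {0} e" and z: "z \<notin> adjoin (adjoin {0} e) y"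
    and \<psi>: "normalized e \<phi> y \<psi>" and \<chi>: "normalized e \<phi> z \<chi>"
  shows "normalized e \<phi> (y + z) (\<lambda>v. \<psi> v + \<chi> v)"
proof -
  have lin: "left_linear \<psi>" "left_linear \<chi>" and ker: "\<And>v. \<psi> v = 0 \<longleftrightarrow> R y v" "\<And>v. \<chi> v = 0 \<longleftrightarrow> R z v"
    and ker': "\<And>v. \<phi> v + \<psi> v = 0 \<longleftrightarrow> R (e + y) v" "\<And>v. \<phi> v + \<chi> v = 0 \<longleftrightarrow> R (e + z) v"
    using \<psi> \<chi> unfolding normalized_def by blast+
  have "e \<notin> adjoin (adjoin {0} y) z"
  proof
    assume e': "e \<in> adjoin (adjoin {0} y) z"
    have "adjoin (adjoin {0} y) e = adjoin (adjoin {0} y) z"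
      by (rule adjoin_exchange[OF lsubspace_ray e' not_ray_sym[OF y]])
    then have "z \<in> adjoin (adjoin {0} y) e" using adjoin_self[OF lsubspace_ray] by blast
    then show False using z adjoin_commute[OF lsubspace_zero] by blast
  qed
  then obtain a' where a': "R y a'" "R z a'" "\<not> R e a'" using separate_plane by blast
  have "y \<notin> adjoin (adjoin {0} e) z"
  proof
    assume y': "y \<in> adjoin (adjoin {0} e) z"
    have "adjoin (adjoin {0} e) y = adjoin (adjoin {0} e) z"
      by (rule adjoin_exchange[OF lsubspace_ray y' y])
    then show False using z adjoin_self[OF lsubspace_ray] by blast
  qed
  then obtain b' where b': "R e b'" "R z b'" "\<not> R y b'" using separate_plane by blast
  obtain c' where c': "R e c'" "R y c'" "\<not> R z c'" using separate_plane[OF z] by blast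
  obtain k l m where k: "\<phi> (k \<cdot> a') = 1" and l: "\<psi> (l \<cdot> b') = 1" and m: "\<chi> (m \<cdot> c') = 1"
    using dual_vector[OF a'(3) \<phi>] dual_vector[OF b'(3) lin(1) ker(1)] dual_vector[OF c'(3) lin(2) ker(2)]
    by metis
  define a b c where "a = k \<cdot> a'" and "b = l \<cdot> b'" and "c = m \<cdot> c'"
  have abc: "\<phi> a = 1" "\<psi> a = 0" "\<chi> a = 0" "\<phi> b = 0" "\<psi> b = 1" "\<chi> b = 0" "\<phi> c = 0" "\<psi> c = 0" "\<chi> c = 1"
    using k l m smul_right[OF a'(1)] smul_right[OF a'(2)] smul_right[OF b'(1)] smul_right[OF b'(2)]
      smul_right[OF c'(1)] smul_right[OF c'(2)] \<phi>(2) ker by (auto simp: a_def b_def c_def)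
  note lins = left_linearD[OF \<phi>(1)] left_linearD[OF lin(1)] left_linearD[OF lin(2)]
  let ?s = "e + (y + z)"
  have Ra: "R y a" "R z a" "\<not> R e a" and Rb: "R e b" "R z b" "\<not> R y b" and Rc: "R e c" "R y c"
    using abc ker \<phi>(2) by (metis zero_neq_one)+
  have "R (e + y) (a - b)" "R z (a - b)" using ker'(1)[of "a - b"] ker(2)[of "a - b"] abc by (simp_all add: lins)
  then have "R (e + y + z) (a - b)" using add_left_iff(1) by blast
  then have ab: "R ?s (a - b)" by (simp add: add.assoc)
  have "R (e + z) (a - c)" "R y (a - c)" using ker'(2)[of "a - c"] ker(1)[of "a - c"] abc by (simp_all add: lins)
  then have "R (e + z + y) (a - c)" using add_left_iff(1) by blast
  then have ac: "R ?s (a - c)" by (simp add: add.commute add.left_commute)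
  have "R ?s ((a - c) - (a - b))" using add_right_iff(3)[OF ab] ac by blast
  then have "R ?s (b - c)" by simp
  moreover have "R e (b - c)" using add_right_iff(3)[OF Rc(1)] Rb(1) by blast
  ultimately have bc: "R (y + z) (b - c)" using add_left_iff(1) by blast
  have Ryza: "R (y + z) a" using add_left_iff(1)[OF Ra(1)] Ra(2) by blast
  have Rsa: "\<not> R ?s a" using add_left_iff(2)[OF Ryza] Ra(3) by blast
  have Ryzb: "\<not> R (y + z) b" using add_left_iff(2)[OF Rb(2)] Rb(3) by blast
  have rest: "R w (v - \<phi> v \<cdot> a - \<psi> v \<cdot> b - \<chi> v \<cdot> c)" if "w \<in> {?s, y + z}" for v w
  proof -
    let ?r = "v - \<phi> v \<cdot> a - \<psi> v \<cdot> b - \<chi> v \<cdot> c"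
    have "\<phi> ?r = 0" "\<psi> ?r = 0" "\<chi> ?r = 0" using abc by (simp_all add: lins)
    then have "R e ?r" "R y ?r" "R z ?r" using \<phi>(2) ker by blast+
    then show ?thesis using that add_left_iff(1) by auto
  qed
  have "\<phi> v + (\<psi> v + \<chi> v) = 0 \<longleftrightarrow> R ?s v" for v
  proof -
    let ?r = "v - \<phi> v \<cdot> a - \<psi> v \<cdot> b - \<chi> v \<cdot> c" and ?t = "\<phi> v + (\<psi> v + \<chi> v)"
    have "v = ?r + ?t \<cdot> a - \<psi> v \<cdot> (a - b) - \<chi> v \<cdot> (a - c)"
      by (simp add: smul_algebra algebra_simps)
    then have "R ?s v \<longleftrightarrow> R ?s (?t \<cdot> a)"
      using add_right_iff(1)[OF rest[of ?s v]] add_right_iff(3)[OF smul_right[OF ab]]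
        add_right_iff(3)[OF smul_right[OF ac]] by (metis insertI1)
    then show ?thesis using smul_right_iff[of ?t ?s a] Rsa zero_right by (cases "?t = 0") auto
  qed
  moreover have "\<psi> v + \<chi> v = 0 \<longleftrightarrow> R (y + z) v" for v
  proof -
    let ?r = "v - \<phi> v \<cdot> a - \<psi> v \<cdot> b - \<chi> v \<cdot> c" and ?t = "\<psi> v + \<chi> v"
    have "v = ?r + ?t \<cdot> b + \<phi> v \<cdot> a - \<chi> v \<cdot> (b - c)"
      by (simp add: smul_algebra algebra_simps)
    then have "R (y + z) v \<longleftrightarrow> R (y + z) (?t \<cdot> b)"
      using add_right_iff(1)[OF rest[of "y + z" v]] add_right_iff(3)[OF smul_right[OF bc]]
        add_right_iff(2)[OF smul_right[OF Ryza]] by (metis insertI1 insertI2)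
    then show ?thesis using smul_right_iff[of ?t "y + z" b] Ryzb zero_right by (cases "?t = 0") auto
  qed
  ultimately show ?thesis unfolding normalized_def using left_linear_add[OF lin] by blast
qed

definition polar_functional :: "('n \<Rightarrow> 'k) \<Rightarrow> ('n \<Rightarrow> 'k) \<Rightarrow> 'k"
  where "polar_functional y = (THE \<psi>. normalized e \<phi> y \<psi>)"

lemma normalized_polar_functional:
  assumes "y \<notin> adjoin {0} e"
  shows "normalized e \<phi> y (polar_functional y)"
proof -
  obtain \<psi> where \<psi>: "normalized e \<phi> y \<psi>" using normalized_ex[OF assms] ..
  have "polar_functional y = \<psi>"
    unfolding polar_functional_def
    by (rule the_equality[of "normalized e \<phi> y", OF \<psi>]) (rule normalized_unique[OF assms _ \<psi>])
  then show ?thesis using \<psi> by simp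
qed

lemma polar_functional_linear: "y \<notin> adjoin {0} e \<Longrightarrow> left_linear (polar_functional y)"
  and polar_functional_eq_0: "y \<notin> adjoin {0} e \<Longrightarrow> polar_functional y v = 0 \<longleftrightarrow> R y v"
  using normalized_polar_functional unfolding normalized_def by blast+

lemma not_ray_add:
  assumes "u \<notin> adjoin (adjoin {0} e) x"
  shows "x + u \<notin> adjoin {0} e" "u \<notin> adjoin {0} e"
proof -
  have "x \<in> adjoin (adjoin {0} e) x" by (rule adjoin_self[OF lsubspace_ray])
  from add_mem_iff(1)[OF lsubspace_adjoin[OF lsubspace_ray] this, of u]
  show "x + u \<notin> adjoin {0} e" "u \<notin> adjoin {0} e"
    using subset_adjoin[of "adjoin {0} e" x] assms by blast+
qed

lemma polar_functional_add:
  assumes y: "y \<notin> adjoin {0} e" and z: "z \<notin> adjoin (adjoin {0} e) y"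
  shows "polar_functional (y + z) v = polar_functional y v + polar_functional z v"
proof -
  have "normalized e \<phi> (y + z) (\<lambda>v. polar_functional y v + polar_functional z v)"
    using normalized_add[OF y z] normalized_polar_functional y not_ray_add[OF z] by blast
  then have "polar_functional (y + z) = (\<lambda>v. polar_functional y v + polar_functional z v)"
    using normalized_unique normalized_polar_functional not_ray_add[OF z] by blast
  then show ?thesis by simp
qed

text \<open>Expand the value at \<open>x + u + w\<close> in two ways. Here \<open>x\<close> may lie
  on the ray of \<open>e\<close>, where \<open>polar_functional\<close> itself is not
  controlled.\<close>

lemma polar_functional_shift:
  assumes u: "u \<notin> adjoin (adjoin {0} e) x" and w: "w \<notin> adjoin (adjoin (adjoin {0} e) x) u"
  shows "polar_functional (x + u) v - polar_functional u v = polar_functional (x + w) v - polar_functional w v"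
proof -
  let ?E = "adjoin {0} e" and ?F = "polar_functional"
  let ?T = "adjoin (adjoin ?E x) u"
  note Ex = lsubspace_adjoin[OF lsubspace_ray, of e x]
  note T = lsubspace_adjoin[OF Ex, of u]
  have ET: "?E \<subseteq> ?T" and xT: "x \<in> ?T" and uT: "u \<in> ?T"
    using subset_adjoin[of ?E x] subset_adjoin[of "adjoin ?E x" u] adjoin_self[OF lsubspace_ray, of x e]
      adjoin_self[OF Ex, of u] by blast+
  have wx: "w \<notin> adjoin ?E x" using w subset_adjoin by blast
  have 1: "w \<notin> adjoin ?E (x + u)"
    using adjoin_subset_iff[OF lsubspace_ray T, of e "x + u"] ET lsubspaceD(2)[OF T xT uT] w by blast
  have 2: "u \<notin> adjoin ?E (x + w)"
  proof
    assume u': "u \<in> adjoin ?E (x + w)"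
    have "adjoin ?E u = adjoin ?E (x + w)"
      by (rule adjoin_exchange[OF lsubspace_ray u' not_ray_add(2)[OF u]])
    then have "x + w \<in> adjoin ?E u" using adjoin_self[OF lsubspace_ray] by blast
    then have "x + w \<in> ?T" using adjoin_subset_iff[OF lsubspace_ray T, of e u] ET uT by blast
    then show False using add_mem_iff(1)[OF T xT] w by blast
  qed
  have "?F (x + u + w) v = ?F (x + u) v + ?F w v"
    by (rule polar_functional_add[OF not_ray_add(1)[OF u] 1])
  moreover have "?F (x + w + u) v = ?F (x + w) v + ?F u v"
    by (rule polar_functional_add[OF not_ray_add(1)[OF wx] 2])
  moreover have "x + w + u = x + u + w" by (simp add: algebra_simps)
  ultimately show ?thesis by (simp add: algebra_simps)
qed

section \<open>The alternating form on the whole space\<close>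

context
  assumes large_dim: "CARD('n) \<ge> 4"
begin

lemma fresh_vector:
  obtains u where "u \<notin> adjoin (adjoin (adjoin {0} e) x) y"
proof -
  have "ldim (adjoin (adjoin (adjoin {0} e) x) y) \<le> 3"
    using ldim_adjoin_le[OF lsubspace_adjoin[OF lsubspace_ray[of e], of x], of y]
      ldim_adjoin_le[OF lsubspace_ray[of e], of x] ldim_adjoin_le[OF lsubspace_zero, of e]
    by (simp add: ldim_zero)
  then have "adjoin (adjoin (adjoin {0} e) x) y \<noteq> UNIV"
    using large_dim ldim_UNIV[where 'n='n and 'k='k] by auto
  then show thesis using that by blast
qed

lemma fresh_vector2:
  obtains u where "u \<notin> adjoin (adjoin {0} e) x"
  using fresh_vector[of x x] subset_adjoin[of "adjoin (adjoin {0} e) x" x] by blast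

lemma fresh_vector1:
  obtains u where "u \<notin> adjoin {0} e"
  using fresh_vector2[of e] subset_adjoin[of "adjoin {0} e" e] by blast

text \<open>If \<open>u\<close> and \<open>w\<close> are dependent modulo \<open>e\<close> and
  \<open>x\<close>, compare both with a third vector \<open>t\<close>.\<close>

lemma polar_functional_shift':
  assumes u: "u \<notin> adjoin (adjoin {0} e) x" and w: "w \<notin> adjoin (adjoin {0} e) x"
  shows "polar_functional (x + u) v - polar_functional u v = polar_functional (x + w) v - polar_functional w v"
proof (cases "w \<in> adjoin (adjoin (adjoin {0} e) x) u")
  case True
  obtain t where t: "t \<notin> adjoin (adjoin (adjoin {0} e) x) u" using fresh_vector by blast
  have "adjoin (adjoin (adjoin {0} e) x) w = adjoin (adjoin (adjoin {0} e) x) u"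
    by (rule adjoin_exchange[OF lsubspace_adjoin[OF lsubspace_ray] True w])
  then show ?thesis using polar_functional_shift[OF u t] polar_functional_shift[OF w, of t] t by simp
qed (rule polar_functional_shift[OF u])

text \<open>Extends \<^const>\<open>polar_functional\<close> additively to the ray spanned by \<open>e\<close>.\<close>
definition form :: "('n \<Rightarrow> 'k) \<Rightarrow> ('n \<Rightarrow> 'k) \<Rightarrow> 'k"
  where "form x v = (let u = (SOME u. u \<notin> adjoin (adjoin {0} e) x)
    in polar_functional (x + u) v - polar_functional u v)"

lemma form_eq:
  assumes u: "u \<notin> adjoin (adjoin {0} e) x"
  shows "polar_functional (x + u) v = form x v + polar_functional u v"
  using polar_functional_shift'[OF someI[of "\<lambda>u. u \<notin> adjoin (adjoin {0} e) x", OF u] u, of v]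
  unfolding form_def Let_def by (simp add: algebra_simps)

lemma form_linear: "left_linear (form x)"
proof -
  obtain u where u: "u \<notin> adjoin (adjoin {0} e) x" using fresh_vector2 by blast
  have "form x = (\<lambda>v. polar_functional (x + u) v - polar_functional u v)"
    using form_eq[OF u] by (simp add: fun_eq_iff)
  then show ?thesis
    using left_linear_diff polar_functional_linear[OF not_ray_add(1)[OF u]]
      polar_functional_linear[OF not_ray_add(2)[OF u]] by simp
qed

text \<open>For \<open>u\<close> outside the span of \<open>e\<close>, \<open>x\<close>,
  \<open>y\<close>, peel \<open>x + y\<close> off \<open>x + y + u\<close> at once, or first
  \<open>x\<close> and then \<open>y\<close>.\<close>

lemma form_add: "form (x + y) v = form x v + form y v"
proof -
  let ?E = "adjoin {0} e"
  let ?T = "adjoin (adjoin ?E x) y"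
  obtain u where u: "u \<notin> ?T" using fresh_vector by blast
  note Ex = lsubspace_adjoin[OF lsubspace_ray, of e x]
  note T = lsubspace_adjoin[OF Ex, of y]
  have ET: "?E \<subseteq> ?T" and xT: "x \<in> ?T" and yT: "y \<in> ?T"
    using subset_adjoin[of ?E x] subset_adjoin[of "adjoin ?E x" y] adjoin_self[OF lsubspace_ray, of x e]
      adjoin_self[OF Ex, of y] by blast+
  have "u \<notin> adjoin ?E (x + y)"
    using adjoin_subset_iff[OF lsubspace_ray T, of e "x + y"] ET lsubspaceD(2)[OF T xT yT] u by blast
  moreover have "u \<notin> adjoin ?E y"
    using adjoin_subset_iff[OF lsubspace_ray T, of e y] ET yT u by blast
  moreover have "y + u \<notin> adjoin ?E x"
    using subset_adjoin[of "adjoin ?E x" y] add_mem_iff(1)[OF T yT] u by blast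
  ultimately show ?thesis
    using form_eq[of u "x + y" v] form_eq[of u y v] form_eq[of "y + u" x v] by (simp add: add.assoc)
qed

lemma form_polar:
  assumes "x \<notin> adjoin {0} e"
  shows "form x v = 0 \<longleftrightarrow> R x v"
proof -
  obtain u where u: "u \<notin> adjoin (adjoin {0} e) x" using fresh_vector2 by blast
  have "form x v = polar_functional x v"
    using form_eq[OF u, of v] polar_functional_add[OF assms u, of v] by simp
  then show ?thesis using polar_functional_eq_0[OF assms] by simp
qed

lemma form_alternating: "form x x = 0"
proof (cases "x \<in> adjoin {0} e")
  case False
  then show ?thesis using form_polar absolute by blast
next
  case True
  \<comment> \<open>For \<open>x\<close> on the ray the symmetric sum does not depend on
    \<open>u\<close>. Being additive in \<open>u\<close> as well, it equals its own double and so
    vanishes.\<close>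
  have sum: "form x u + form u x = - form x x" if u: "u \<notin> adjoin {0} e" for u
  proof -
    have "x + u \<notin> adjoin {0} e" using add_mem_iff(1)[OF lsubspace_ray True] u by blast
    then have "form (x + u) (x + u) = 0" "form u u = 0" using form_polar u absolute by blast+
    moreover have "form (x + u) (x + u) = (form x x + form x u) + (form u x + form u u)"
      by (simp only: form_add left_linearD(1)[OF form_linear] ac_simps)
    ultimately have "form x x + (form x u + form u x) = 0" by (simp add: add.assoc)
    then show ?thesis by (simp only: add_eq_0_iff)
  qed
  obtain u where u: "u \<notin> adjoin {0} e" using fresh_vector1 by blast
  obtain w where w: "w \<notin> adjoin (adjoin {0} e) u" using fresh_vector2 by blast
  have "form x (u + w) + form (u + w) x = (form x u + form u x) + (form x w + form w x)"
    by (simp only: form_add left_linearD(1)[OF form_linear] ac_simps)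
  then have "- form x x = - form x x + - form x x"
    by (simp only: sum[OF u] sum[OF not_ray_add(2)[OF w]] sum[OF not_ray_add(1)[OF w]])
  then show ?thesis by simp
qed

lemma form_skew: "form x y = - form y x"
proof -
  have "form (x + y) (x + y) = (form x x + form x y) + (form y x + form y y)"
    by (simp only: form_add left_linearD(1)[OF form_linear] ac_simps)
  then have "form y x + form x y = 0" by (simp add: form_alternating add.commute)
  then show ?thesis by (simp only: add_eq_0_iff)
qed

lemma form_eq_0_iff: "form x y = 0 \<longleftrightarrow> R x y"
proof (cases "x \<in> adjoin {0} e \<and> y \<in> adjoin {0} e")
  case True
  then obtain a b where ab: "x = a \<cdot> e" "y = b \<cdot> e" unfolding adjoin_def by auto
  \<comment> \<open>Scalars come out only of the second argument, so skewness is used to bring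
    \<open>a\<close> there.\<close>
  have "form (a \<cdot> e) (b \<cdot> e) = b * - (a * form e e)"
    using left_linearD(3)[OF form_linear] form_skew by metis
  then show ?thesis using ab absolute form_alternating smul_left smul_right by simp
next
  case False
  then show ?thesis using form_polar[of x y] form_polar[of y x] form_skew[of x y] sym_iff[of x y] by auto
qed

end

end

theorem alternating_form_ex:
  assumes "CARD('n) \<ge> 4"
  shows "\<exists>f. (\<forall>x. left_linear (f x)) \<and> (\<forall>x y v. f (x + y) v = f x v + f y v) \<and>
    (\<forall>x. f x x = 0) \<and> (\<forall>x v. f x v = 0 \<longleftrightarrow> R x v)"
proof -
  \<comment> \<open>Any nonzero vector would serve.\<close>
  define e :: "'n \<Rightarrow> 'k" where "e = (\<lambda>_. 1)"
  have e: "e \<noteq> 0" by (simp add: e_def fun_eq_iff)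
  have "e \<notin> {0}" using e by blast
  then obtain a where "\<not> R e a" using separation[OF lsubspace_zero] by blast
  then obtain \<phi> where \<phi>: "left_linear \<phi>" "\<And>v. \<phi> v = 0 \<longleftrightarrow> R e v" using functional_ex by blast
  show ?thesis
    using form_linear[OF e \<phi> assms] form_add[OF e \<phi> assms] form_alternating[OF e \<phi> assms]
      form_eq_0_iff[OF e \<phi> assms] by blast
qed

end

subsection \<open>Dualities of projective space\<close>

text \<open>Skewness moves a scalar to the second argument and back:
  \<open>f (c \<cdot> x) y = - f y (c \<cdot> x) = c * f x y\<close>. Taking the scalars out of
  \<open>f (a \<cdot> p) (b \<cdot> q)\<close> in both orders then makes \<open>a\<close> and
  \<open>b\<close> commute.\<close>

lemma alternating_imp_bilinear:
  fixes f :: "('n \<Rightarrow> 'k::division_ring) \<Rightarrow> ('n \<Rightarrow> 'k) \<Rightarrow> 'k"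
  assumes lin: "\<And>x. left_linear (f x)" and add: "\<And>x y v. f (x + y) v = f x v + f y v"
    and alt: "\<And>x. f x x = 0"
  shows "f (c \<cdot> x) y = c * f x y" and "f p q \<noteq> 0 \<Longrightarrow> a * b = b * (a :: 'k)"
proof -
  have skew: "f x y = - f y x" for x y
  proof -
    have "f (x + y) (x + y) = (f x x + f x y) + (f y x + f y y)"
      by (simp only: add left_linearD(1)[OF lin] ac_simps)
    then have "f y x + f x y = 0" by (simp add: alt add.commute)
    then show ?thesis by (simp only: add_eq_0_iff)
  qed
  show scale: "f (c \<cdot> x) y = c * f x y" for c x y
    using skew[of "c \<cdot> x" y] skew[of x y] left_linearD(3)[OF lin, of y c x] by simp
  assume "f p q \<noteq> 0"
  moreover have "a * (b * f p q) = b * (a * f p q)"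
    using scale[of a p "b \<cdot> q"] left_linearD(3)[OF lin, of "a \<cdot> p" b q]
      left_linearD(3)[OF lin, of p b q] scale[of a p q] by simp
  ultimately show "a * b = b * a" by (simp flip: mult.assoc)
qed

locale pg_duality =
  fixes \<theta> :: "('n::finite \<Rightarrow> 'k::division_ring) set \<Rightarrow> ('n \<Rightarrow> 'k) set"
  assumes dual: "duality (CARD('n) - 1) (pg_vertices (CARD('n) - 1)) ldim pg_inc \<theta>"
    and card: "CARD('n) \<ge> 2"
begin

abbreviation "vertices \<equiv> pg_vertices (CARD('n) - 1) :: ('n \<Rightarrow> 'k) set set"
abbreviation "ray x \<equiv> adjoin {0} (x :: 'n \<Rightarrow> 'k)"

lemma dual_bij: "bij_betw \<theta> vertices vertices"
  using dual unfolding duality_def by (elim conjE)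

lemma vertex_mem: "S \<in> vertices \<Longrightarrow> \<theta> S \<in> vertices"
  using bij_betw_apply[OF dual_bij] .

lemma vertex_surj: "S \<in> vertices \<Longrightarrow> \<exists>T\<in>vertices. \<theta> T = S"
  using bij_betw_imp_surj_on[OF dual_bij] by (metis imageE)

lemma vertex_lsubspace: "S \<in> vertices \<Longrightarrow> lsubspace S"
  using pg_vertices_iff by blast

lemma ldim_dual: "S \<in> vertices \<Longrightarrow> ldim (\<theta> S) = CARD('n) - ldim S"
  using dual card unfolding duality_def by simp

text \<open>A duality preserves only the symmetric incidence; the reversal of dimensions decides the
  direction of the inclusion, since the wrong one forces \<open>S = T\<close>.\<close>

lemma dual_subset_iff:
  assumes S: "S \<in> vertices" and T: "T \<in> vertices"
  shows "\<theta> T \<subseteq> \<theta> S \<longleftrightarrow> S \<subseteq> T"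
proof -
  note sub = vertex_lsubspace[OF S] vertex_lsubspace[OF T]
    vertex_lsubspace[OF vertex_mem[OF S]] vertex_lsubspace[OF vertex_mem[OF T]]
  have inc: "pg_inc S T \<longleftrightarrow> pg_inc (\<theta> S) (\<theta> T)" using dual S T unfolding duality_def by blast
  have eq: "S = T" if "lsubspace S" "lsubspace T" "S \<subseteq> T" "CARD('n) - ldim S \<le> CARD('n) - ldim T"
    for S T :: "('n \<Rightarrow> 'k) set"
  proof (rule ldim_mono(2)[OF that(1-3)])
    show "ldim S = ldim T" using ldim_mono(1)[OF that(1-3)] ldim_le(1)[OF that(2)] that(4) by arith
  qed
  have 1: "S = T" if "\<theta> S \<subseteq> \<theta> T" "S \<subseteq> T"
    using eq[OF sub(1,2) that(2)] ldim_mono(1)[OF sub(3,4) that(1)] ldim_dual[OF S] ldim_dual[OF T] by simp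
  have 2: "T = S" if "\<theta> T \<subseteq> \<theta> S" "T \<subseteq> S"
    using eq[OF sub(2,1) that(2)] ldim_mono(1)[OF sub(4,3) that(1)] ldim_dual[OF S] ldim_dual[OF T] by simp
  show ?thesis using inc 1 2 unfolding pg_inc_def by blast
qed

lemma ray_subset_iff: "lsubspace S \<Longrightarrow> ray x \<subseteq> S \<longleftrightarrow> x \<in> S"
  using adjoin_subset_iff[OF lsubspace_zero, of S x] lsubspaceD(1) by blast

lemma ldim_ray: "x \<noteq> 0 \<Longrightarrow> ldim (ray x) = 1"
  using ldim_adjoin[OF lsubspace_zero, of x] ldim_zero by simp

lemma ray_vertex: "x \<noteq> 0 \<Longrightarrow> ray x \<in> vertices"
  unfolding pg_vertices_def using ldim_ray[of x] card lsubspace_adjoin[OF lsubspace_zero, of x] by auto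

text \<open>The zero vector spans no vertex, so the value of \<open>\<theta>\<close> on its ray is
  bypassed.\<close>

definition orth :: "('n \<Rightarrow> 'k) \<Rightarrow> ('n \<Rightarrow> 'k) \<Rightarrow> bool"
  where "orth x y \<longleftrightarrow> x = 0 \<or> y \<in> \<theta> (ray x)"

text \<open>\<open>T\<close> is the preimage of \<open>ray y\<close> under \<open>\<theta>\<close>,
  that is, the left polar of \<open>y\<close>: inclusion of \<open>\<theta> T\<close> in
  \<open>\<theta> U\<close> reverses to \<open>U \<subseteq> T\<close>.\<close>

lemma polar_vertex:
  assumes "y \<noteq> 0"
  obtains T where "T \<in> vertices" "\<And>x. orth x y \<longleftrightarrow> x \<in> T" "\<And>U. U \<in> vertices \<Longrightarrow> y \<in> \<theta> U \<longleftrightarrow> U \<subseteq> T"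
proof -
  obtain T where T: "T \<in> vertices" "\<theta> T = ray y" using vertex_surj[OF ray_vertex[OF assms]] by blast
  have U: "y \<in> \<theta> U \<longleftrightarrow> U \<subseteq> T" if "U \<in> vertices" for U
    using ray_subset_iff[OF vertex_lsubspace[OF vertex_mem[OF that]], of y] dual_subset_iff[OF that T(1)] T(2)
    by simp
  moreover have "orth x y \<longleftrightarrow> x \<in> T" for x
    using U[OF ray_vertex, of x] ray_subset_iff[OF vertex_lsubspace[OF T(1)], of x]
      lsubspaceD(1)[OF vertex_lsubspace[OF T(1)]] unfolding orth_def by (cases "x = 0") auto
  ultimately show thesis using that T(1) by blast
qed

lemma orth_zero: "orth x 0"
  using lsubspaceD(1)[OF vertex_lsubspace[OF vertex_mem[OF ray_vertex]]] by (auto simp: orth_def)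

lemma dual_eq_orth:
  assumes "U \<in> vertices"
  shows "\<theta> U = {y. \<forall>x\<in>U. orth x y}"
proof -
  have "y \<in> \<theta> U \<longleftrightarrow> (\<forall>x\<in>U. orth x y)" for y
  proof (cases "y = 0")
    case True
    then show ?thesis using orth_zero lsubspaceD(1)[OF vertex_lsubspace[OF vertex_mem[OF assms]]] by simp
  next
    case False
    then show ?thesis using polar_vertex[of y] assms by (metis subset_iff)
  qed
  then show ?thesis by blast
qed

sublocale dual_relation orth
proof
  fix x y :: "'n \<Rightarrow> 'k"
  show "lsubspace {y. orth x y}"
  proof (cases "x = 0")
    case False
    then show ?thesis using vertex_lsubspace[OF vertex_mem[OF ray_vertex[OF False]]] by (simp add: orth_def)
  qed (simp add: orth_def lsubspace_UNIV)
  show "lsubspace {x. orth x y}"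
  proof (cases "y = 0")
    case False
    then obtain T where "T \<in> vertices" "\<And>x. orth x y \<longleftrightarrow> x \<in> T" using polar_vertex by metis
    then show ?thesis using vertex_lsubspace by simp
  qed (simp add: orth_zero lsubspace_UNIV)
  show "\<exists>c. orth x (z - c \<cdot> y)" if "\<not> orth x y" for z
  proof -
    have x: "x \<noteq> 0" "y \<notin> \<theta> (ray x)" using that by (auto simp: orth_def)
    note S = vertex_lsubspace[OF vertex_mem[OF ray_vertex[OF x(1)]]]
    have "ldim (adjoin (\<theta> (ray x)) y) = CARD('n)"
      using ldim_adjoin[OF S x(2)] ldim_dual[OF ray_vertex[OF x(1)]] ldim_ray[OF x(1)] card by simp
    then have "adjoin (\<theta> (ray x)) y = UNIV" using ldim_le(2)[OF lsubspace_adjoin[OF S]] by blast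
    then have "z \<in> adjoin (\<theta> (ray x)) y" by simp
    then show ?thesis by (auto simp: adjoin_def orth_def)
  qed
next
  fix U h assume U: "lsubspace U" and sep: "\<And>y. \<forall>u\<in>U. orth u y \<Longrightarrow> orth h y"
  show "h \<in> U"
  proof (rule ccontr)
    assume h: "h \<notin> U"
    then have "h \<noteq> 0" using lsubspaceD(1)[OF U] by blast
    note rh = ray_vertex[OF this]
    have orth_h: "orth h y \<longleftrightarrow> y \<in> \<theta> (ray h)" for y using \<open>h \<noteq> 0\<close> by (simp add: orth_def)
    show False
    proof (cases "U = {0}")
      case True
      then have "\<theta> (ray h) = UNIV" using sep orth_h by (auto simp: orth_def)
      then show False using vertex_mem[OF rh] pg_vertices_iff by blast
    next
      case False
      then have Uv: "U \<in> vertices" using pg_vertices_iff U h by blast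
      \<comment> \<open>Reversing this inclusion puts \<open>h\<close> into
        \<open>U\<close>.\<close>
      have "\<theta> U \<subseteq> \<theta> (ray h)"
      proof
        fix y assume "y \<in> \<theta> U"
        then have "\<forall>u\<in>U. orth u y" using dual_eq_orth[OF Uv] by simp
        then show "y \<in> \<theta> (ray h)" using sep orth_h by simp
      qed
      then show False using dual_subset_iff[OF rh Uv] ray_subset_iff[OF U] h by simp
    qed
  qed
qed

lemma perp_eq_dual: "U \<in> vertices \<Longrightarrow> perp U = \<theta> U"
  using dual_eq_orth by (simp add: perp_def)

lemma ldim_perp:
  assumes U: "lsubspace U"
  shows "ldim U + ldim (perp U) = CARD('n)"
proof -
  consider "U = {0}" | "U = UNIV" | "U \<in> vertices" using U pg_vertices_iff by blast
  then show ?thesis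
  proof cases
    case 1
    then have "perp U = UNIV" by (auto simp: perp_def orth_def)
    then show ?thesis using 1 by (simp add: ldim_zero ldim_UNIV)
  next
    case 2
    have "y = 0" if "y \<in> perp U" for y
    proof (rule ccontr)
      assume "y \<noteq> 0"
      then obtain T where T: "T \<in> vertices" "\<And>x. orth x y \<longleftrightarrow> x \<in> T" using polar_vertex by metis
      then have "T = UNIV" using that 2 by (auto simp: perp_def)
      then show False using T(1) pg_vertices_iff by blast
    qed
    then have "perp U = {0}" using lsubspaceD(1)[OF lsubspace_perp] by blast
    then show ?thesis using 2 by (simp add: ldim_zero ldim_UNIV)
  next
    case 3
    then show ?thesis using ldim_dual perp_eq_dual ldim_le(1)[OF U] by simp
  qed
qed

lemma domestic_not_transversal:
  assumes dom: "domestic (CARD('n) - 1) vertices ldim pg_inc \<theta>"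
  shows "\<not> transversal UNIV"
proof
  assume "transversal UNIV"
  from transversal_complete_flag[OF this] obtain F where F: "complete_flag F" and triv: "\<And>i. i \<le> CARD('n) \<Longrightarrow> F i \<inter> perp (F i) = {0}"
    by blast
  \<comment> \<open>Polars reverse inclusion, hence the reversed index; the chamber of
    \<open>G\<close> is the image under \<open>\<theta>\<close> of the chamber of
    \<open>F\<close>.\<close>
  define G where "G i = perp (F (CARD('n) - i))" for i
  have G: "complete_flag G"
    unfolding complete_flag_def
  proof (intro conjI allI impI)
    fix i assume i: "i \<le> CARD('n)"
    show "lsubspace (G i)" unfolding G_def by (rule lsubspace_perp)
    show "ldim (G i) = i"
      using ldim_perp[OF flag_lsubspace[OF F, of "CARD('n) - i"]] flag_ldim[OF F, of "CARD('n) - i"] i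
      by (simp add: G_def)
  next
    fix i j :: nat assume "i \<le> j" "j \<le> CARD('n)"
    then have "F (CARD('n) - j) \<subseteq> F (CARD('n) - i)" using flag_mono[OF F] by simp
    then show "G i \<subseteq> G j" unfolding G_def perp_def by blast
  qed
  let ?J = "{1..CARD('n) - 1}"
  have vert: "F i \<in> vertices" if "i \<in> ?J" for i
    using flag_lsubspace[OF F, of i] flag_ldim[OF F, of i] that unfolding pg_vertices_def by auto
  have "\<theta> (F i) = G (CARD('n) - i)" if "i \<in> ?J" for i
  proof -
    have "CARD('n) - (CARD('n) - i) = i" using that by auto
    then show ?thesis using perp_eq_dual[OF vert[OF that]] by (simp add: G_def)
  qed
  then have "\<theta> ` F ` ?J = G ` (\<lambda>i. CARD('n) - i) ` ?J" unfolding image_image by (rule image_cong[OF refl])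
  also have "(\<lambda>i. CARD('n) - i) ` ?J = ?J" by (rule endo_inj_surj) (auto simp: inj_on_def)
  finally have "\<theta> ` flag_chamber F = flag_chamber G" by (simp add: flag_chamber_def)
  moreover have "F i \<inter> G (CARD('n) - i) \<subseteq> {0}" if "i \<in> ?J" for i
  proof -
    have "CARD('n) - (CARD('n) - i) = i" "i \<le> CARD('n)" using that by auto
    then show ?thesis using triv[of i] by (simp add: G_def)
  qed
  ultimately show False
    using dom transversal_opposite[OF F G] pg_chamber_flag_chamber[OF F] unfolding domestic_def by metis
qed

theorem domestic_symplectic:
  assumes large: "card (UNIV :: 'k set) \<noteq> 2" and card4: "CARD('n) \<ge> 4"
    and dom: "domestic (CARD('n) - 1) vertices ldim pg_inc \<theta>"
  shows "even CARD('n)" and "symplectic_polarity (CARD('n) - 1) \<theta>"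
proof -
  \<comment> \<open>An infinite \<open>K\<close> has \<open>card\<close> 0 and so satisfies
    \<open>large\<close>; only the two-element ring is excluded.\<close>
  have "\<exists>a::'k. a \<noteq> 0 \<and> a \<noteq> 1"
  proof (rule ccontr)
    assume "\<not> ?thesis"
    then have "UNIV = {0, 1 :: 'k}" by auto
    then have "card (UNIV :: 'k set) = card {0, 1 :: 'k}" by (rule arg_cong)
    then show False using large by simp
  qed
  then obtain a :: 'k where a: "a \<noteq> 0" "a \<noteq> 1" by blast
  interpret null_relation orth
    by unfold_locales (rule all_absolute[OF domestic_not_transversal[OF dom] a])
  show "even CARD('n)" by (rule even_dim[OF ldim_perp])
  obtain f where lin: "\<And>x. left_linear (f x)" and add: "\<And>x y v. f (x + y) v = f x v + f y v"
    and alt: "\<And>x. f x x = 0" and zero: "\<And>x v. f x v = 0 \<longleftrightarrow> orth x v"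
    using alternating_form_ex[OF card4] by blast
  note bil = alternating_imp_bilinear[OF lin add alt]
  have nondeg: "x = 0" if "\<forall>y. f x y = 0" for x
    using separation[OF lsubspace_zero, of x] that zero by blast
  define e :: "'n \<Rightarrow> 'k" where "e = (\<lambda>_. 1)"
  have "e \<noteq> 0" by (simp add: e_def fun_eq_iff)
  then obtain q where "f e q \<noteq> 0" using nondeg by blast
  then have comm: "a * b = b * a" for a b :: 'k by (rule bil(2))
  have comb: "(\<lambda>i. a * x i + b * y i) = a \<cdot> x + b \<cdot> y" for a b and x y :: "'n \<Rightarrow> 'k"
    by (simp add: smul_def plus_fun_def)
  have "f (\<lambda>i. a * x i + b * y i) z = a * f x z + b * f y z"
    "f z (\<lambda>i. a * x i + b * y i) = a * f z x + b * f z y" for a b x y z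
    by (simp_all add: comb add bil(1) left_linearD(1,3)[OF lin])
  moreover have "x = (\<lambda>i. 0)" if "\<forall>y. f x y = 0" for x
    using nondeg[OF that] by (simp add: zero_fun_def)
  moreover have "\<theta> U = {y. \<forall>x\<in>U. f x y = 0}" if "U \<in> vertices" for U
    using dual_eq_orth[OF that] zero by simp
  ultimately show "symplectic_polarity (CARD('n) - 1) \<theta>"
    unfolding symplectic_polarity_def using comm alt by blast
qed

end

theorem theorem3p5:
  shows
  "(\<forall>(P :: 'p set) (L :: 'l set) I (\<theta> :: 'p + 'l \<Rightarrow> 'p + 'l).
      proj_plane P L I \<and> large_plane P L I \<and>
      duality 2 (plane_vertices P L) plane_typ (plane_inc I) \<theta> \<and>
      domestic 2 (plane_vertices P L) plane_typ (plane_inc I) \<theta>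
      \<longrightarrow> odd (2::nat)) \<and>
   (\<forall>\<theta> :: ('n::finite \<Rightarrow> 'k::division_ring) set \<Rightarrow> ('n \<Rightarrow> 'k) set.
      CARD('n) \<ge> 4 \<and> card (UNIV :: 'k set) \<noteq> 2 \<and>
      duality (CARD('n) - 1) (pg_vertices (CARD('n) - 1)) ldim pg_inc \<theta> \<and>
      domestic (CARD('n) - 1) (pg_vertices (CARD('n) - 1)) ldim pg_inc \<theta>
      \<longrightarrow> odd (CARD('n) - 1) \<and> symplectic_polarity (CARD('n) - 1) \<theta>)"
proof (intro conjI allI impI)
  fix P :: "'p set" and L :: "'l set" and I \<theta>
  assume *: "proj_plane P L I \<and> large_plane P L I \<and>
      duality 2 (plane_vertices P L) plane_typ (plane_inc I) \<theta> \<and>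
      domestic 2 (plane_vertices P L) plane_typ (plane_inc I) \<theta>"
  then interpret projective_plane P L I by unfold_locales blast
  \<comment> \<open>The goal is false, so this case asserts that no domestic duality exists.\<close>
  show "odd (2::nat)" using duality_not_domestic * by blast
next
  fix \<theta> :: "('n::finite \<Rightarrow> 'k::division_ring) set \<Rightarrow> ('n \<Rightarrow> 'k) set"
  assume *: "CARD('n) \<ge> 4 \<and> card (UNIV :: 'k set) \<noteq> 2 \<and>
      duality (CARD('n) - 1) (pg_vertices (CARD('n) - 1)) ldim pg_inc \<theta> \<and>
      domestic (CARD('n) - 1) (pg_vertices (CARD('n) - 1)) ldim pg_inc \<theta>"
  then interpret pg_duality \<theta> by unfold_locales auto
  show "odd (CARD('n) - 1)" using domestic_symplectic(1) * by auto
  show "symplectic_polarity (CARD('n) - 1) \<theta>" using domestic_symplectic(2) * by blast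
qed

end
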